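(* Consider the linear time-invariant system $z(t+1)=Az(t)+\sigma\xi(t)$ with $z(t)\in\mathbb{R}^N$, $\sigma>0$, $\xi(0),\xi(1),\ldots$ i.i.d. Gaussian vectors in $\mathbb{R}^N$ with zero mean and identity covariance, and Gaussian initial condition $z(0)$, independent of the noise, with covariance $\Sigma(0)$. Let $\Sigma(t)$ be the covariance of $z(t)$, so $\Sigma(t)=A\Sigma(t-1)A^\top+\sigma^2I$. Split $z=(x^\top,y^\top)^\top$ and $$A=\begin{pmatrix} A_x & A_{xy} \\ A_{yx} & A_y \end{pmatrix},\qquad \Sigma(t)=\begin{pmatrix}\Sigma_x(t)&\Sigma_{xy}(t)\\ \Sigma_{xy}(t)^\top&\Sigma_y(t)\end{pmatrix},$$ and split further $x=(x_1^\top,x_2^\top)^\top$, so that $A_{yx}=(A_{yx_1}\;\,A_{yx_2})$ and $$\Sigma(t)=\begin{pmatrix}\Sigma_{x_1}&\Sigma_{x_1x_2}&\Sigma_{x_1y}\\ \Sigma_{x_1x_2}^\top&\Sigma_{x_2}&\Sigma_{x_2y}\\ \Sigma_{x_1y}^\top&\Sigma_{x_2y}^\top&\Sigma_y\end{pmatrix}(t).$$ Let $t\ge 0$ be such that $\Sigma_y(t)$ is invertible. Then $$[T_{x\to y}]_t^{t+1}=\frac12\log\frac{|A_{yx}\Sigma^s_y(t)A_{yx}^\top+\sigma^2I|}{|\sigma^2 I|},$$ where $\Sigma^s_y(t)=\Sigma_x(t)-\Sigma_{xy}(t)\Sigma_y(t)^{-1}\Sigma_{xy}(t)^\top$ is the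 Schur complement of $\Sigma_y(t)$ in $\Sigma(t)$, and $$[T_{x_1\to y}]_t^{t+1}=\frac12\log\frac{|A_{yx}\Sigma^s_y(t)A_{yx}^\top+\sigma^2I|}{|A_{yx_2}(\Sigma^s_y)_{yx_2}(t)A_{yx_2}^\top+\sigma^2I|},$$ where $(\Sigma^s_y)_{yx_2}(t)=\Sigma_{x_2}(t)-\Sigma_{x_2y}(t)\Sigma_y(t)^{-1}\Sigma_{x_2y}(t)^\top$ is the Schur complement of $\Sigma_y(t)$ in $\begin{pmatrix}\Sigma_{x_2}(t)&\Sigma_{x_2y}(t)\\ \Sigma_{x_2y}(t)^\top&\Sigma_y(t)\end{pmatrix}$. Here $|\cdot|$ denotes the determinant and $I$ the identity matrix of the size of $y$.
   Context: Information transfer: for disjoint groups of state components $a$ and $y$ of a stochastic dynamical system, the one-step information transfer from $a$ to $y$ from time $t$ to $t+1$ is $$[T_{a\to y}]_t^{t+1}=H(y(t+1)\mid y(t))-H_{\not a}(y(t+1)\mid y(t)),$$ where $H(\cdot\mid\cdot)$ is conditional differential (Shannon) entropy and $H_{\not a}$ is the same conditional entropy computed for the system in which $a$ is frozen. Freezing $a$ over the time window starting at $t$ means: $a$ is held at a constant (deterministic) value over the window and its update equations are dropped, while the remaining components have at time $t$ the same (marginal) joint distribution as in the original system and evolve according to their own update equations with their own noise. For the linear system, up to a constant shift (which does not affect entropies), this amounts to deleting from $A$ the rows and columns belonging to $a$. Thus when $x$ is frozen, $y'=A_yy+\sigma\xi_y$; when $x_1$ is frozen, $x_2'=A_{x_2}x_2+A_{x_2y}y+\sigma\xi_{x_2}$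 and $y'=A_{yx_2}x_2+A_yy+\sigma\xi_y$. *)

theory Defs
  imports "HOL-Probability.Probability"
begin

text \<open>Gaussian vectors are the affine images of the standard normal law, so singular
  covariance matrices and point masses are included. A square \<open>B\<close> loses no generality, since
  every covariance matrix has a square root.\<close>

definition std_gaussian :: "(real ^ 'n) measure" where
  "std_gaussian = density lborel (\<lambda>w. ennreal (\<Prod>i\<in>UNIV. std_normal_density (w $ i)))"

definition gaussian_vector :: "'a measure \<Rightarrow> ('a \<Rightarrow> real ^ 'n) \<Rightarrow> bool" where
  "gaussian_vector M X \<longleftrightarrow>
     X \<in> borel_measurable M \<and>
     (\<exists>(\<mu> :: real ^ 'n) (B :: real ^ 'n ^ 'n).
        distr M borel X = distr std_gaussian borel (\<lambda>w. \<mu> + B *v w))"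

definition cov_matrix :: "'a measure \<Rightarrow> ('a \<Rightarrow> real ^ 'n) \<Rightarrow> real ^ 'n ^ 'n" where
  "cov_matrix M X =
     (\<chi> i j. \<integral>\<omega>. (X \<omega> $ i - (\<integral>\<omega>'. X \<omega>' $ i \<partial>M)) * (X \<omega> $ j - (\<integral>\<omega>'. X \<omega>' $ j \<partial>M)) \<partial>M)"

text \<open>A group of components is given by a map from its own index type into the full index type.\<close>

definition subvec :: "('k \<Rightarrow> 'n) \<Rightarrow> real ^ 'n \<Rightarrow> real ^ 'k" where
  "subvec f v = (\<chi> i. v $ f i)"

definition submat :: "('k \<Rightarrow> 'm) \<Rightarrow> ('l \<Rightarrow> 'n) \<Rightarrow> real ^ 'n ^ 'm \<Rightarrow> real ^ 'l ^ 'k" where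
  "submat f g A = (\<chi> i j. A $ f i $ g j)"

definition schur_compl :: "real ^ 'k ^ 'k \<Rightarrow> real ^ 'l ^ 'k \<Rightarrow> real ^ 'l ^ 'l \<Rightarrow> real ^ 'k ^ 'k" where
  "schur_compl P Q R = P - Q ** matrix_inv R ** transpose Q"

definition linear_step ::
  "real ^ 'n ^ 'n \<Rightarrow> real \<Rightarrow> real ^ 'n \<Rightarrow> real ^ 'n \<Rightarrow> real ^ 'n" where
  "linear_step A \<sigma> v w = A *v v + \<sigma> *\<^sub>R w"

definition freeze :: "'n set \<Rightarrow> real ^ 'n \<Rightarrow> real ^ 'n \<Rightarrow> real ^ 'n" where
  "freeze a c v = (\<chi> i. if i \<in> a then c $ i else v $ i)"

text \<open>Differential conditional entropy, to base \<open>b\<close>: the reference measures are Lebesgue.\<close>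

definition diff_cond_entropy ::
  "'a measure \<Rightarrow> real \<Rightarrow> ('a \<Rightarrow> real ^ 'k) \<Rightarrow> ('a \<Rightarrow> real ^ 'l) \<Rightarrow> real" where
  "diff_cond_entropy M b U V = prob_space.conditional_entropy M b lborel lborel U V"

text \<open>Information transfer from the components in \<open>a\<close> to the group \<open>y\<close> for
  \<open>z (t + 1) = F (z t) (\<xi> t)\<close>. The frozen system starts at time \<open>t\<close> from \<open>z t\<close> with the
  components in \<open>a\<close> replaced by those of the constant \<open>c\<close>, so that the other components keep
  their joint law; in the step to \<open>t + 1\<close> they follow \<open>F\<close> with the same noise, while the
  components in \<open>a\<close> stay at \<open>c\<close>.\<close>

definition info_transfer ::
  "'a measure \<Rightarrow> real \<Rightarrow> (real ^ 'n \<Rightarrow> 'w \<Rightarrow> real ^ 'n) \<Rightarrow> (nat \<Rightarrow> 'a \<Rightarrow> real ^ 'n) \<Rightarrow>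
   (nat \<Rightarrow> 'a \<Rightarrow> 'w) \<Rightarrow> real ^ 'n \<Rightarrow> 'n set \<Rightarrow> ('k::finite \<Rightarrow> 'n) \<Rightarrow> nat \<Rightarrow> real" where
  "info_transfer M b F z \<xi> c a y t =
     diff_cond_entropy M b (\<lambda>\<omega>. subvec y (z (t + 1) \<omega>)) (\<lambda>\<omega>. subvec y (z t \<omega>)) -
     diff_cond_entropy M b
       (\<lambda>\<omega>. subvec y (freeze a c (F (freeze a c (z t \<omega>)) (\<xi> t \<omega>))))
       (\<lambda>\<omega>. subvec y (freeze a c (z t \<omega>)))"

end

theory Submission
  imports Defs
begin

text \<open>By induction every state is an affine image \<open>\<mu> + B w\<close> of a standard normal vector, so in one step
  \<open>(y(t+1), y(t))\<close> is affine in a standard normal vector \<open>W = (w, \<xi>(t))\<close>. Subtracting from \<open>y(t+1)\<close> its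
  linear regression on \<open>y(t)\<close> leaves a residual \<open>r + K W\<close>, while \<open>y(t) = v + L W\<close> with
  \<open>K L\<^sup>T = 0\<close>; \<open>K K\<^sup>T\<close> is the Schur complement expression of the theorem. Writing
  \<open>K K\<^sup>T = C C\<^sup>T\<close> and \<open>L L\<^sup>T = D D\<^sup>T\<close> with square \<open>C\<close>, \<open>D\<close>, the matrix with row blocks
  \<open>C\<^sup>-\<^sup>1 K\<close> and \<open>D\<^sup>-\<^sup>1 L\<close> is a coisometry and maps the standard normal law to the standard
  normal law. Hence the residual is independent of \<open>y(t)\<close>, and the conditional entropy is the
  entropy of \<open>C a\<close> for a standard normal \<open>a\<close>, namely \<open>log |det C|\<close> plus a constant that cancels in the
  transfer. Freezing \<open>x\<^sub>1\<close> only turns its contribution to \<open>y(t+1)\<close> into a constant.\<close>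

subsection \<open>Lebesgue measure under linear maps\<close>

text \<open>The change of variables theorems of \<open>HOL-Analysis\<close> assume a wellordered index type, which is
  not available here.\<close>

lemma prod_Basis_cart:
  fixes g :: "real ^ 'n \<Rightarrow> 'b::comm_monoid_mult"
  shows "(\<Prod>b\<in>Basis. g b) = (\<Prod>i\<in>UNIV. g (axis i 1))"
proof -
  have "Basis = range (\<lambda>i::'n. axis i (1::real))"
    by (auto simp: Basis_vec_def)
  moreover have "inj (\<lambda>i::'n. axis i (1::real))"
    by (auto simp: inj_on_def axis_eq_axis)
  ultimately show ?thesis
    using prod.reindex[of "\<lambda>i. axis i 1" UNIV g] by (metis (no_types, lifting) comp_apply prod.cong)
qed

lemma measurable_vec_lambda [measurable]:
  fixes f :: "'a \<Rightarrow> 'n::finite \<Rightarrow> real"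
  assumes "\<And>i. (\<lambda>x. f x i) \<in> borel_measurable M"
  shows "(\<lambda>x. \<chi> i. f x i) \<in> borel_measurable M"
proof (subst borel_measurable_euclidean_space, rule ballI)
  fix b :: "real ^ 'n" assume "b \<in> Basis"
  then obtain i where "b = axis i 1"
    by (auto simp: Basis_vec_def)
  then show "(\<lambda>x. (\<chi> i. f x i) \<bullet> b) \<in> borel_measurable M"
    using assms by (simp add: inner_axis)
qed

lemma measurable_vec_nth' [measurable (raw)]:
  fixes f :: "'a \<Rightarrow> real ^ 'n"
  assumes "f \<in> borel_measurable M"
  shows "(\<lambda>x. f x $ i) \<in> borel_measurable M"
  using borel_measurable_inner[OF assms borel_measurable_const[of "axis i 1"]]
  by (simp add: inner_axis)

lemma measurable_matrix_vector_mult [measurable (raw)]: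
  fixes A :: "real ^ 'n ^ 'm"
  assumes "f \<in> borel_measurable M"
  shows "(\<lambda>x. A *v f x) \<in> borel_measurable M"
  unfolding matrix_vector_mult_def using assms by measurable

lemma measurable_subvec [measurable (raw)]:
  fixes g :: "'k::finite \<Rightarrow> 'n::finite"
  assumes "f \<in> borel_measurable M"
  shows "(\<lambda>x. subvec g (f x)) \<in> borel_measurable M"
  unfolding subvec_def using assms by measurable

lemma lborel_cart:
  "lborel = distr (\<Pi>\<^sub>M i\<in>(UNIV :: 'n::finite set). lborel) borel (\<lambda>f. \<chi> i. (f i :: real))"
proof (rule lborel_eqI)
  interpret product_sigma_finite "\<lambda>_::'n. lborel :: real measure"
    by standard
  fix l u :: "real ^ 'n"
  assume le: "\<And>b. b \<in> Basis \<Longrightarrow> l \<bullet> b \<le> u \<bullet> b"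
  have lu: "l $ i \<le> u $ i" for i
    using le[of "axis i 1"] by (simp add: inner_axis)
  have [measurable]: "(\<lambda>f::'n\<Rightarrow>real. \<chi> i. f i) \<in> borel_measurable (\<Pi>\<^sub>M i\<in>UNIV. lborel)"
    by measurable
  have eq: "(\<lambda>f. \<chi> i. f i) -` box l u \<inter> space (\<Pi>\<^sub>M i\<in>UNIV. lborel) = (\<Pi>\<^sub>E i\<in>UNIV. {l $ i <..< u $ i})"
    by (auto simp: mem_box_cart space_PiM PiE_def Pi_def)
  have "emeasure (\<Pi>\<^sub>M i\<in>UNIV. lborel) (\<Pi>\<^sub>E i\<in>UNIV. {l $ i <..< u $ i})
      = (\<Prod>i\<in>UNIV. ennreal (u $ i - l $ i))"
    by (subst emeasure_PiM) (auto simp: lu)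
  then show "emeasure (distr (\<Pi>\<^sub>M i\<in>UNIV. lborel) borel (\<lambda>f. \<chi> i. f i)) (box l u)
      = (\<Prod>b\<in>Basis. (u - l) \<bullet> b)"
    by (simp add: emeasure_distr eq prod_Basis_cart inner_axis prod_ennreal lu)
qed simp

lemma nn_integral_lborel_cart:
  fixes f :: "real ^ 'n \<Rightarrow> ennreal"
  assumes [measurable]: "f \<in> borel_measurable borel"
  shows "(\<integral>\<^sup>+x. f x \<partial>lborel) = (\<integral>\<^sup>+x. f (\<chi> i. x i) \<partial>(\<Pi>\<^sub>M i\<in>UNIV. lborel))"
  by (subst lborel_cart) (simp add: nn_integral_distr)

lemma distr_lborel_shear:
  fixes m n :: "'n::finite"
  assumes "m \<noteq> n"
  shows "distr lborel borel (\<lambda>x::real ^ 'n. \<chi> i. if i = m then x $ m + x $ n else x $ i) = lborel"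
    (is "distr _ _ ?h = _")
proof (rule measure_eqI)
  fix S assume "S \<in> sets (distr lborel borel ?h)"
  then have [measurable]: "S \<in> sets borel" by simp
  have [measurable]: "?h \<in> borel_measurable borel"
    by measurable
  interpret product_sigma_finite "\<lambda>_::'n. lborel :: real measure"
    by standard
  let ?I = "UNIV - {m}"
  let ?P = "\<lambda>J. \<Pi>\<^sub>M i\<in>(J :: 'n set). (lborel :: real measure)"
  have U: "insert m ?I = UNIV" by auto
  have iter: "(\<integral>\<^sup>+x. f x \<partial>lborel) = (\<integral>\<^sup>+x. \<integral>\<^sup>+y. f (\<chi> i. (x(m := y)) i) \<partial>lborel \<partial>?P ?I)"
    if [measurable]: "f \<in> borel_measurable borel" for f :: "real ^ 'n \<Rightarrow> ennreal"
  proof -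
    have "(\<lambda>x. f (\<chi> i. x i)) \<in> borel_measurable (?P UNIV)" by measurable
    then show ?thesis
      using product_nn_integral_insert[of ?I m "\<lambda>x. f (\<chi> i. x i)"]
      unfolding U by (simp add: nn_integral_lborel_cart)
  qed
  have "emeasure (distr lborel borel ?h) S = (\<integral>\<^sup>+x. indicator S (?h x) \<partial>lborel)"
    by (simp add: nn_integral_distr flip: nn_integral_indicator)
  also have "\<dots> = (\<integral>\<^sup>+x. \<integral>\<^sup>+y. indicator S (\<chi> i. (x(m := x n + 1 * y)) i) \<partial>lborel \<partial>?P ?I)"
    using assms by (subst iter) (auto intro!: nn_integral_cong arg_cong2[where f=indicator] simp: vec_eq_iff)
  also have "\<dots> = (\<integral>\<^sup>+x. \<integral>\<^sup>+y. indicator S (\<chi> i. (x(m := y)) i) \<partial>lborel \<partial>?P ?I)"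
  proof (rule nn_integral_cong)
    fix x assume "x \<in> space (?P ?I)"
    have "(\<lambda>y. indicator S (\<chi> i. (x(m := y)) i) :: ennreal) \<in> borel_measurable borel"
    proof -
      have "(\<lambda>y. \<chi> i. (x(m := y)) i) \<in> borel_measurable borel"
        by (rule measurable_vec_lambda) simp
      then show ?thesis by measurable
    qed
    from nn_integral_real_affine[OF this, of 1 "x n"]
    show "(\<integral>\<^sup>+y. indicator S (\<chi> i. (x(m := x n + 1 * y)) i) \<partial>lborel)
        = (\<integral>\<^sup>+y. indicator S (\<chi> i. (x(m := y)) i) \<partial>lborel)" by simp
  qed
  also have "\<dots> = emeasure lborel S"
    by (subst iter[symmetric]) auto
  finally show "emeasure (distr lborel borel ?h) S = emeasure lborel S" .
qed simp

lemma distr_lborel_permute: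
  fixes p :: "'n::finite \<Rightarrow> 'n"
  assumes "bij p"
  shows "distr lborel borel (\<lambda>x::real ^ 'n. \<chi> i. x $ p i) = lborel"
proof (rule lborel_eqI[symmetric])
  fix l u :: "real ^ 'n"
  assume le: "\<And>b. b \<in> Basis \<Longrightarrow> l \<bullet> b \<le> u \<bullet> b"
  have lu: "l $ i \<le> u $ i" for i
    using le[of "axis i 1"] by (simp add: inner_axis)
  have bq: "bij (inv p)" "\<And>i. inv p (p i) = i" "\<And>i. p (inv p i) = i"
    using assms by (auto simp: bij_imp_bij_inv bij_is_inj bij_is_surj surj_f_inv_f)
  have eq: "(\<lambda>x::real ^ 'n. \<chi> i. x $ p i) -` box l u = box (\<chi> i. l $ inv p i) (\<chi> i. u $ inv p i)"
    unfolding set_eq_iff mem_box_cart vimage_eq vec_lambda_beta by (metis bq(2,3))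
  show "emeasure (distr lborel borel (\<lambda>x::real ^ 'n. \<chi> i. x $ p i)) (box l u) = (\<Prod>b\<in>Basis. (u - l) \<bullet> b)"
  proof (subst emeasure_distr)
    have "(\<chi> i. l $ inv p i) \<bullet> b \<le> (\<chi> i. u $ inv p i) \<bullet> b" if "b \<in> Basis" for b
      using that by (auto simp: Basis_vec_def inner_axis lu)
    then show "emeasure lborel ((\<lambda>x::real ^ 'n. \<chi> i. x $ p i) -` box l u \<inter> space lborel) = (\<Prod>b\<in>Basis. (u - l) \<bullet> b)"
      by (simp add: eq prod_Basis_cart inner_axis prod.reindex_bij_betw[OF bq(1), of "\<lambda>i. u $ i - l $ i"])
  qed simp_all
qed simp

lemma distr_lborel_stretch:
  fixes c :: "'n::finite \<Rightarrow> real"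
  assumes "\<And>i. c i \<noteq> 0"
  shows "lborel = density (distr lborel borel (\<lambda>x. \<chi> i. c i * x $ i)) (\<lambda>_. \<bar>prod c UNIV\<bar>)"
proof -
  have "lborel = density (distr lborel borel
      (\<lambda>x::real ^ 'n. 0 + (\<Sum>j\<in>Basis. ((\<chi> i. c i) \<bullet> j * (x \<bullet> j)) *\<^sub>R j))) (\<lambda>_. \<Prod>j\<in>Basis. \<bar>(\<chi> i. c i) \<bullet> j\<bar>)"
    by (rule lborel_affine_euclidean) (auto simp: Basis_vec_def inner_axis assms)
  moreover have "0 + (\<Sum>j\<in>Basis. ((\<chi> i. c i) \<bullet> j * (x \<bullet> j)) *\<^sub>R j) = (\<chi> i. c i * x $ i)" for x :: "real ^ 'n"
  proof (rule euclidean_eqI)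
    fix b :: "real ^ 'n" assume b: "b \<in> Basis"
    then obtain i where "b = axis i 1"
      by (auto simp: Basis_vec_def)
    then show "(0 + (\<Sum>j\<in>Basis. ((\<chi> i. c i) \<bullet> j * (x \<bullet> j)) *\<^sub>R j)) \<bullet> b = (\<chi> i. c i * x $ i) \<bullet> b"
      using inner_sum_left_Basis[OF b, of "\<lambda>j. (\<chi> i. c i) \<bullet> j * (x \<bullet> j)"] by (simp add: inner_axis)
  qed
  ultimately show ?thesis
    by (simp add: prod_Basis_cart inner_axis abs_prod)
qed

lemma lborel_linear_image:
  fixes f :: "real ^ 'n \<Rightarrow> real ^ 'n"
  assumes "linear f" and "det (matrix f) \<noteq> 0"
  shows "lborel = density (distr lborel borel f) (\<lambda>_. \<bar>det (matrix f)\<bar>)"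
proof -
  have "det (matrix f) \<noteq> 0 \<longrightarrow> lborel = density (distr lborel borel f) (\<lambda>_. \<bar>det (matrix f)\<bar>)"
  proof (rule induct_linear_elementary[OF \<open>linear f\<close>])
    fix f g :: "real ^ 'n \<Rightarrow> real ^ 'n"
    assume lin: "linear f" "linear g"
      and f: "det (matrix f) \<noteq> 0 \<longrightarrow> lborel = density (distr lborel borel f) (\<lambda>_. \<bar>det (matrix f)\<bar>)"
      and g: "det (matrix g) \<noteq> 0 \<longrightarrow> lborel = density (distr lborel borel g) (\<lambda>_. \<bar>det (matrix g)\<bar>)"
    have [measurable]: "f \<in> borel_measurable borel" "g \<in> borel_measurable borel"
      using lin by (auto intro!: borel_measurable_continuous_onI linear_continuous_on simp: linear_linear)
    show "det (matrix (f \<circ> g)) \<noteq> 0 \<longrightarrow> lborel = density (distr lborel borel (f \<circ> g)) (\<lambda>_. \<bar>det (matrix (f \<circ> g))\<bar>)"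
    proof
      have fg: "det (matrix (f \<circ> g)) = det (matrix f) * det (matrix g)"
        using lin by (simp add: matrix_compose det_mul)
      assume "det (matrix (f \<circ> g)) \<noteq> 0"
      then have "lborel = density (distr (density (distr lborel borel g) (\<lambda>_. \<bar>det (matrix g)\<bar>)) borel f) (\<lambda>_. \<bar>det (matrix f)\<bar>)"
        using f g fg by (metis mult_eq_0_iff)
      also have "distr (density (distr lborel borel g) (\<lambda>_. ennreal \<bar>det (matrix g)\<bar>)) borel f
          = density (distr (distr lborel borel g) borel f) (\<lambda>_. \<bar>det (matrix g)\<bar>)"
        by (rule density_distr[symmetric]) auto
      finally show "lborel = density (distr lborel borel (f \<circ> g)) (\<lambda>_. \<bar>det (matrix (f \<circ> g))\<bar>)"
        by (simp add: density_density_eq distr_distr fg abs_mult ennreal_mult mult.commute)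
    qed
  next
    fix f :: "real ^ 'n \<Rightarrow> real ^ 'n" and i
    assume "linear f" and 0: "\<And>x. f x $ i = 0"
    then have "\<not> inj f"
      by (metis (full_types) linear_injective_imp_surjective one_neq_zero surjE vec_component)
    then show "det (matrix f) \<noteq> 0 \<longrightarrow> lborel = density (distr lborel borel f) (\<lambda>_. \<bar>det (matrix f)\<bar>)"
      using det_nz_iff_inj[OF \<open>linear f\<close>] by blast
  next
    fix c :: "'n \<Rightarrow> real"
    have "det (matrix (\<lambda>x. \<chi> i. c i * x $ i)) = prod c UNIV"
      by (simp add: axis_def matrix_def det_diagonal)
    then show "det (matrix (\<lambda>x. \<chi> i. c i * x $ i)) \<noteq> 0 \<longrightarrow>
      lborel = density (distr lborel borel (\<lambda>x. \<chi> i. c i * x $ i)) (\<lambda>_. \<bar>det (matrix (\<lambda>x. \<chi> i. c i * x $ i))\<bar>)"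
      by (auto intro!: distr_lborel_stretch)
  next
    fix m n :: 'n assume "m \<noteq> n"
    let ?h = "\<lambda>v::real ^ 'n. \<chi> i. v $ Transposition.transpose m n i"
    have "(\<chi> i j. if Transposition.transpose m n i = j then 1 else 0) = (\<chi> i j. if j = Transposition.transpose m n i then 1 else (0::real))"
      by (auto intro!: Cart_lambda_cong)
    then have "matrix ?h = transpose (\<chi> i j. mat 1 $ i $ Transposition.transpose m n j)"
      by (auto simp: matrix_eq transpose_def axis_def mat_def matrix_def)
    then have "\<bar>det (matrix ?h)\<bar> = 1"
      by (simp add: det_permute_columns permutes_swap_id sign_swap_id abs_mult)
    then show "det (matrix ?h) \<noteq> 0 \<longrightarrow> lborel = density (distr lborel borel ?h) (\<lambda>_. \<bar>det (matrix ?h)\<bar>)"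
      by (simp add: distr_lborel_permute density_1)
  next
    fix m n :: 'n assume mn: "m \<noteq> n"
    let ?h = "\<lambda>v::real ^ 'n. \<chi> i. if i = m then v $ m + v $ n else v $ i"
    have "matrix ?h = (\<chi> k. if k = m then row m (mat 1) + 1 *s row n (mat 1) else row k (mat 1))"
      by (auto simp: matrix_def axis_def row_def mat_def vec_eq_iff)
    then have "det (matrix ?h) = 1"
      using det_row_operation[OF mn, of "mat 1 :: real ^ 'n ^ 'n" 1] by simp
    then show "det (matrix ?h) \<noteq> 0 \<longrightarrow> lborel = density (distr lborel borel ?h) (\<lambda>_. \<bar>det (matrix ?h)\<bar>)"
      using distr_lborel_shear[OF mn] by (simp add: density_1)
  qed
  with assms(2) show ?thesis by blast
qed

subsection \<open>The standard normal law\<close>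

lemma prod_std_normal_density:
  fixes w :: "real ^ 'n"
  shows "(\<Prod>i\<in>UNIV. std_normal_density (w $ i)) = (1 / sqrt (2 * pi)) ^ CARD('n) * exp (- (norm w)\<^sup>2 / 2)"
proof -
  have "(norm w)\<^sup>2 = (\<Sum>i\<in>UNIV. (w $ i)\<^sup>2)"
    unfolding power2_norm_eq_inner by (simp add: inner_vec_def power2_eq_square)
  then show ?thesis
    by (simp add: std_normal_density_def prod_dividef power_divide sum_divide_distrib sum_negf flip: exp_sum)
qed

lemma measurable_prod_std_normal_density [measurable]:
  "(\<lambda>w::real ^ 'n. \<Prod>i\<in>UNIV. std_normal_density (w $ i)) \<in> borel_measurable borel"
  unfolding prod_std_normal_density by measurable

lemma sets_std_gaussian [simp, measurable_cong]: "sets std_gaussian = sets borel"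
  by (simp add: std_gaussian_def)

lemma space_std_gaussian [simp]: "space std_gaussian = UNIV"
  by (simp add: std_gaussian_def)

lemma distr_std_gaussian_nth:
  fixes i :: "'n::finite"
  shows "distr std_gaussian borel (\<lambda>w::real ^ 'n. w $ i) = density lborel std_normal_density"
proof (rule measure_eqI)
  fix S assume "S \<in> sets (distr std_gaussian borel (\<lambda>w::real ^ 'n. w $ i))"
  then have [measurable]: "S \<in> sets borel" by simp
  interpret product_sigma_finite "\<lambda>_::'n. lborel :: real measure"
    by standard
  have nth: "(\<lambda>w::real ^ 'n. w $ i) \<in> borel_measurable borel"
    by measurable
  let ?f = "\<lambda>j x. ennreal (std_normal_density x) * (if j = i then indicator S x else 1)"
  have "emeasure (distr std_gaussian borel (\<lambda>w::real ^ 'n. w $ i)) S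
      = (\<integral>\<^sup>+(w::real ^ 'n). ennreal (\<Prod>j\<in>UNIV. std_normal_density (w $ j)) * indicator S (w $ i) \<partial>lborel)"
    unfolding std_gaussian_def
    using measurable_sets_borel[OF nth \<open>S \<in> sets borel\<close>]
    by (subst emeasure_distr, measurable, subst emeasure_density)
      (auto intro!: nn_integral_cong split: split_indicator)
  also have "\<dots> = (\<integral>\<^sup>+(w::real ^ 'n). (\<Prod>j\<in>UNIV. ?f j (w $ j)) \<partial>lborel)"
    by (simp add: prod.distrib prod.delta prod_ennreal)
  also have "\<dots> = (\<integral>\<^sup>+w. (\<Prod>j\<in>UNIV. ?f j (w j)) \<partial>(\<Pi>\<^sub>M i\<in>UNIV. lborel))"
    by (subst nn_integral_lborel_cart) (auto intro!: nn_integral_cong prod.cong)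
  also have "\<dots> = (\<Prod>j\<in>UNIV. \<integral>\<^sup>+x. ?f j x \<partial>lborel)"
    by (rule product_nn_integral_prod) auto
  also have "\<dots> = (\<Prod>j\<in>UNIV. if j = i then emeasure (density lborel std_normal_density) S else 1)"
  proof (rule prod.cong)
    fix j
    have "(\<integral>\<^sup>+x. ennreal (std_normal_density x) \<partial>lborel) = 1"
      using prob_space.emeasure_space_1[OF prob_space_normal_density[of 1 0]]
      by (simp add: emeasure_density)
    then show "(\<integral>\<^sup>+x. ?f j x \<partial>lborel) = (if j = i then emeasure (density lborel std_normal_density) S else 1)"
      by (simp add: emeasure_density)
  qed simp
  also have "\<dots> = emeasure (density lborel std_normal_density) S"
    by (simp add: prod.delta)
  finally show "emeasure (distr std_gaussian borel (\<lambda>w::real ^ 'n. w $ i)) S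
      = emeasure (density lborel std_normal_density) S" .
qed simp

lemma prob_space_std_gaussian: "prob_space (std_gaussian :: (real ^ 'n) measure)"
proof -
  have "prob_space (distr std_gaussian borel (\<lambda>w::real ^ 'n. w $ undefined))"
    unfolding distr_std_gaussian_nth by (rule prob_space_normal_density) simp
  then show ?thesis
    by (rule prob_space_distrD[rotated]) measurable
qed

lemma distr_std_gaussian_orthogonal_transformation:
  fixes f :: "real ^ 'n \<Rightarrow> real ^ 'n"
  assumes "orthogonal_transformation f"
  shows "distr std_gaussian borel f = std_gaussian"
proof -
  have lin: "linear f" and nrm: "norm (f x) = norm x" for x
    using assms by (auto simp: orthogonal_transformation)
  have [measurable]: "f \<in> borel_measurable borel"
    using lin by (auto intro!: borel_measurable_continuous_onI linear_continuous_on simp: linear_linear)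
  have "\<bar>det (matrix f)\<bar> = 1"
    using assms by simp
  then have "distr lborel borel f = lborel"
    using lborel_linear_image[OF lin] by (auto simp: density_1)
  then have "std_gaussian = density (distr lborel borel f) (\<lambda>w. ennreal (\<Prod>i\<in>UNIV. std_normal_density (w $ i)))"
    by (simp add: std_gaussian_def)
  also have "\<dots> = distr (density lborel (\<lambda>w. ennreal (\<Prod>i\<in>UNIV. std_normal_density (f w $ i)))) borel f"
    by (rule density_distr) auto
  also have "\<dots> = distr std_gaussian borel f"
    by (simp add: std_gaussian_def prod_std_normal_density nrm)
  finally show ?thesis by simp
qed

definition join_vec :: "(real ^ 'm) \<times> (real ^ 'n) \<Rightarrow> real ^ ('m + 'n)" where
  "join_vec p = (\<chi> k. case k of Inl i \<Rightarrow> fst p $ i | Inr j \<Rightarrow> snd p $ j)"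

lemma join_vec_nth [simp]:
  "join_vec p $ Inl i = fst p $ i" "join_vec p $ Inr j = snd p $ j"
  by (simp_all add: join_vec_def)

lemma subvec_join_vec [simp]:
  "subvec Inl (join_vec p) = fst p" "subvec Inr (join_vec p) = snd p"
  by (simp_all add: subvec_def vec_eq_iff)

lemma join_vec_subvec [simp]: "join_vec (subvec Inl v, subvec Inr v) = v"
  by (simp add: join_vec_def subvec_def vec_eq_iff split: sum.split)

lemma sum_UNIV_sum:
  fixes f :: "'a::finite + 'b::finite \<Rightarrow> 'c::comm_monoid_add"
  shows "(\<Sum>k\<in>UNIV. f k) = (\<Sum>i\<in>UNIV. f (Inl i)) + (\<Sum>j\<in>UNIV. f (Inr j))"
  unfolding UNIV_sum by (subst sum.union_disjoint) (auto simp: sum.reindex)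

lemma prod_UNIV_sum:
  fixes f :: "'a::finite + 'b::finite \<Rightarrow> 'c::comm_monoid_mult"
  shows "(\<Prod>k\<in>UNIV. f k) = (\<Prod>i\<in>UNIV. f (Inl i)) * (\<Prod>j\<in>UNIV. f (Inr j))"
  unfolding UNIV_sum by (subst prod.union_disjoint) (auto simp: prod.reindex)

lemma measurable_join_vec [measurable]:
  "(join_vec :: (real ^ 'm) \<times> (real ^ 'n) \<Rightarrow> _) \<in> borel_measurable (borel \<Otimes>\<^sub>M borel)"
  unfolding join_vec_def
proof (rule measurable_vec_lambda)
  fix k :: "'m + 'n"
  show "(\<lambda>p::(real ^ 'm) \<times> (real ^ 'n). case k of Inl i \<Rightarrow> fst p $ i | Inr j \<Rightarrow> snd p $ j)
      \<in> borel_measurable (borel \<Otimes>\<^sub>M borel)"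
    by (cases k) simp_all
qed

lemma lborel_join_vec:
  "distr (lborel \<Otimes>\<^sub>M lborel) borel (join_vec :: (real ^ 'm) \<times> (real ^ 'n) \<Rightarrow> _) = lborel"
proof (rule lborel_eqI[symmetric])
  fix l u :: "real ^ ('m + 'n)"
  assume le: "\<And>b. b \<in> Basis \<Longrightarrow> l \<bullet> b \<le> u \<bullet> b"
  have lu: "l $ i \<le> u $ i" for i
    using le[of "axis i 1"] by (simp add: inner_axis)
  let ?J = "join_vec :: (real ^ 'm) \<times> (real ^ 'n) \<Rightarrow> _"
  have J: "?J \<in> borel_measurable (lborel \<Otimes>\<^sub>M lborel)" by measurable
  have pre: "?J -` box l u \<inter> space (lborel \<Otimes>\<^sub>M lborel)
      = box (subvec Inl l) (subvec Inl u) \<times> box (subvec Inr l) (subvec Inr u)"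
    by (auto simp: mem_box_cart subvec_def space_pair_measure join_vec_def split: sum.splits)
  have em: "emeasure lborel (box (subvec g l) (subvec g u)) = ennreal (\<Prod>i\<in>UNIV. u $ g i - l $ g i)"
    for g :: "'k::finite \<Rightarrow> 'm + 'n"
  proof -
    have "subvec g l \<bullet> b \<le> subvec g u \<bullet> b" if "b \<in> Basis" for b
      using that by (auto simp: Basis_vec_def inner_axis lu subvec_def)
    then show ?thesis
      by (simp add: prod_Basis_cart inner_axis subvec_def)
  qed
  show "emeasure (distr (lborel \<Otimes>\<^sub>M lborel) borel ?J) (box l u) = (\<Prod>b\<in>Basis. (u - l) \<bullet> b)"
    by (simp add: emeasure_distr[OF J] pre lborel.emeasure_pair_measure_Times em prod_Basis_cart
        inner_axis prod_UNIV_sum lu prod_nonneg ennreal_mult)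
qed simp

lemma std_gaussian_join_vec:
  "distr (std_gaussian \<Otimes>\<^sub>M std_gaussian) borel (join_vec :: (real ^ 'm) \<times> (real ^ 'n) \<Rightarrow> _) = std_gaussian"
proof -
  interpret std: prob_space "std_gaussian :: (real ^ 'n) measure"
    by (rule prob_space_std_gaussian)
  let ?J = "join_vec :: (real ^ 'm) \<times> (real ^ 'n) \<Rightarrow> _"
  have "std_gaussian = density (distr (lborel \<Otimes>\<^sub>M lborel) borel ?J) (\<lambda>w. ennreal (\<Prod>i\<in>UNIV. std_normal_density (w $ i)))"
    by (simp add: std_gaussian_def lborel_join_vec)
  also have "\<dots> = distr (density (lborel \<Otimes>\<^sub>M lborel) (\<lambda>p. ennreal (\<Prod>i\<in>UNIV. std_normal_density (?J p $ i)))) borel ?J"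
    by (rule density_distr) auto
  also have "density (lborel \<Otimes>\<^sub>M lborel) (\<lambda>p. ennreal (\<Prod>i\<in>UNIV. std_normal_density (?J p $ i)))
      = std_gaussian \<Otimes>\<^sub>M std_gaussian"
    unfolding std_gaussian_def
    by (subst pair_measure_density)
      (auto simp: prod_UNIV_sum ennreal_mult prod_nonneg split_beta' lborel.sigma_finite_measure_axioms
        std.sigma_finite_measure_axioms[unfolded std_gaussian_def])
  finally show ?thesis by simp
qed

lemma distr_std_gaussian_split:
  "distr (std_gaussian :: (real ^ ('m::finite + 'n::finite)) measure) (borel \<Otimes>\<^sub>M borel) (\<lambda>v. (subvec Inl v, subvec Inr v))
   = std_gaussian \<Otimes>\<^sub>M (std_gaussian :: (real ^ 'n) measure)"
proof -
  have "distr (std_gaussian :: (real ^ ('m + 'n)) measure) (borel \<Otimes>\<^sub>M borel) (\<lambda>v. (subvec Inl v, subvec Inr v))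
     = distr (std_gaussian \<Otimes>\<^sub>M std_gaussian) (borel \<Otimes>\<^sub>M borel) (\<lambda>p. p)"
    by (subst std_gaussian_join_vec[symmetric], subst distr_distr) (auto simp: o_def)
  also have "\<dots> = std_gaussian \<Otimes>\<^sub>M std_gaussian"
    by (rule distr_id2) (simp cong: sets_pair_measure_cong)
  finally show ?thesis .
qed

lemma distr_std_gaussian_subvec_Inl:
  "distr (std_gaussian :: (real ^ ('m::finite + 'n::finite)) measure) borel (subvec Inl) = std_gaussian"
proof -
  interpret std: prob_space "std_gaussian :: (real ^ 'n) measure"
    by (rule prob_space_std_gaussian)
  have "distr (std_gaussian :: (real ^ ('m + 'n)) measure) borel (subvec Inl)
      = distr (std_gaussian \<Otimes>\<^sub>M (std_gaussian :: (real ^ 'n) measure)) borel fst"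
    by (subst distr_std_gaussian_split[symmetric], subst distr_distr) (auto simp: o_def)
  also have "\<dots> = distr (std_gaussian \<Otimes>\<^sub>M (std_gaussian :: (real ^ 'n) measure)) std_gaussian fst"
    by (rule distr_cong) auto
  finally show ?thesis
    by (simp add: std.distr_pair_fst std.emeasure_space_1[simplified])
qed

lemma distr_std_gaussian_subvec_Inr:
  "distr (std_gaussian :: (real ^ ('m::finite + 'n::finite)) measure) borel (subvec Inr) = std_gaussian"
proof -
  interpret std: prob_space "std_gaussian :: (real ^ 'm) measure"
    by (rule prob_space_std_gaussian)
  interpret std': prob_space "std_gaussian :: (real ^ 'n) measure"
    by (rule prob_space_std_gaussian)
  interpret pair_prob_space "std_gaussian :: (real ^ 'm) measure" "std_gaussian :: (real ^ 'n) measure" ..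
  have "distr (std_gaussian :: (real ^ ('m + 'n)) measure) borel (subvec Inr)
      = distr ((std_gaussian :: (real ^ 'm) measure) \<Otimes>\<^sub>M std_gaussian) borel snd"
    by (subst distr_std_gaussian_split[symmetric], subst distr_distr) (auto simp: o_def)
  also have "\<dots> = distr ((std_gaussian :: (real ^ 'n) measure) \<Otimes>\<^sub>M (std_gaussian :: (real ^ 'm) measure)) std_gaussian fst"
    by (subst distr_pair_swap, subst distr_distr) (auto simp: o_def split_beta intro!: distr_cong)
  finally show ?thesis
    by (simp add: std.distr_pair_fst std.emeasure_space_1[simplified])
qed

lemma norm_join_vec: "(norm (join_vec p))\<^sup>2 = (norm (fst p))\<^sup>2 + (norm (snd p))\<^sup>2"
  by (simp add: power2_norm_eq_inner inner_vec_def sum_UNIV_sum)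

text \<open>The involution \<open>(w, w') \<mapsto> (w - Q\<^sup>T Q w + Q\<^sup>T w', Q w)\<close> is orthogonal, and it exchanges
  \<open>Q w\<close> with an independent standard normal vector.\<close>

lemma distr_std_gaussian_coisometry:
  fixes Q :: "real ^ 'm ^ 'n"
  assumes Q: "Q ** transpose Q = mat 1"
  shows "distr std_gaussian borel (\<lambda>w. Q *v w) = std_gaussian"
proof -
  let ?l = "subvec Inl :: real ^ ('m + 'n) \<Rightarrow> real ^ 'm"
  let ?r = "subvec Inr :: real ^ ('m + 'n) \<Rightarrow> real ^ 'n"
  define f where "f v = join_vec (?l v - transpose Q *v (Q *v ?l v) + transpose Q *v ?r v, Q *v ?l v)" for v
  have lin_sub: "subvec g (x + y) = subvec g x + subvec g y" "subvec g (c *\<^sub>R x) = c *\<^sub>R subvec g x"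
    for g :: "'k::finite \<Rightarrow> 'm + 'n" and x y c
    by (simp_all add: subvec_def vec_eq_iff)
  have lin_join: "join_vec (p + q) = join_vec p + join_vec q" "join_vec (c *\<^sub>R p) = c *\<^sub>R join_vec p"
    for p q :: "(real ^ 'm) \<times> (real ^ 'n)" and c
    by (auto simp: join_vec_def vec_eq_iff split: sum.split)
  have "linear f"
  proof (rule linearI)
    show "f (x + y) = f x + f y" for x y
      unfolding f_def lin_join[symmetric]
      by (simp add: lin_sub matrix_vector_right_distrib algebra_simps)
    show "f (c *\<^sub>R x) = c *\<^sub>R f x" for c x
      unfolding f_def lin_join[symmetric]
      by (simp add: lin_sub matrix_vector_mult_scaleR algebra_simps)
  qed
  moreover have "norm (f v) = norm v" for v
  proof -
    define a b where "a = ?l v" and "b = ?r v"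
    have QQ: "Q *v (transpose Q *v x) = x" for x
      by (simp add: matrix_vector_mul_assoc Q del: transpose_matrix_vector)
    have adj: "x \<bullet> (transpose Q *v y) = (Q *v x) \<bullet> y" for x y
      by (simp add: dot_lmul_matrix flip: vector_transpose_matrix)
    have adj': "(transpose Q *v y) \<bullet> x = y \<bullet> (Q *v x)" for x y
      using adj by (simp add: inner_commute)
    have "(norm (f v))\<^sup>2 = (norm a)\<^sup>2 + (norm b)\<^sup>2"
      unfolding f_def norm_join_vec a_def[symmetric] b_def[symmetric]
      by (simp add: power2_norm_eq_inner inner_add_left inner_add_right inner_diff_left inner_diff_right
          adj adj' QQ inner_commute del: transpose_matrix_vector)
    also have "\<dots> = (norm v)\<^sup>2"
      using norm_join_vec[of "(a, b)"] by (simp add: a_def b_def)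
    finally show ?thesis by simp
  qed
  ultimately have f: "orthogonal_transformation f"
    by (simp add: orthogonal_transformation)
  have [measurable]: "f \<in> borel_measurable borel"
    using \<open>linear f\<close> by (auto intro!: borel_measurable_continuous_onI linear_continuous_on simp: linear_linear)
  have "distr std_gaussian borel (\<lambda>w. Q *v w) = distr std_gaussian borel (\<lambda>v. Q *v ?l v)"
    by (subst distr_std_gaussian_subvec_Inl[symmetric, where 'n='n], subst distr_distr) (auto simp: o_def)
  also have "\<dots> = distr (distr std_gaussian borel f) borel ?r"
    by (subst distr_distr) (auto simp: o_def f_def)
  also have "\<dots> = std_gaussian"
    by (simp add: distr_std_gaussian_orthogonal_transformation[OF f] distr_std_gaussian_subvec_Inr)
  finally show ?thesis .
qed

lemma integrable_std_gaussian_nth [simp]: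
  "integrable std_gaussian (\<lambda>w::real ^ 'n. w $ i)"
  using integrable_std_normal_distribution_moment[of 1]
  unfolding distr_std_gaussian_nth[of i, symmetric]
  by (subst (asm) integrable_distr_eq) auto

lemma integrable_std_gaussian_nth_square:
  "integrable std_gaussian (\<lambda>w::real ^ 'n. (w $ i)\<^sup>2)"
  using integrable_std_normal_distribution_moment[of 2]
  unfolding distr_std_gaussian_nth[of i, symmetric]
  by (subst (asm) integrable_distr_eq) auto

lemma integral_std_gaussian_nth [simp]:
  "(\<integral>(w::real ^ 'n). w $ i \<partial>std_gaussian) = 0"
proof -
  have "(\<integral>x. x ^ 1 \<partial>distr std_gaussian borel (\<lambda>w::real ^ 'n. w $ i)) = 0"
    unfolding distr_std_gaussian_nth by (rule integral_std_normal_distribution_moment_odd) simp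
  then show ?thesis
    by (subst (asm) integral_distr) auto
qed

lemma integrable_std_gaussian_mult [simp]:
  "integrable std_gaussian (\<lambda>w::real ^ 'n. w $ i * w $ j)"
proof (rule Bochner_Integration.integrable_bound)
  show "integrable std_gaussian (\<lambda>w::real ^ 'n. (w $ i)\<^sup>2 + (w $ j)\<^sup>2)"
    by (intro Bochner_Integration.integrable_add integrable_std_gaussian_nth_square)
  show "AE w in std_gaussian. norm (w $ i * w $ j) \<le> norm ((w $ i)\<^sup>2 + (w $ j)\<^sup>2)"
  proof (rule AE_I2)
    fix w :: "real ^ 'n"
    have "2 * \<bar>w $ i * w $ j\<bar> \<le> (w $ i)\<^sup>2 + (w $ j)\<^sup>2"
      using sum_squares_bound[of "\<bar>w $ i\<bar>" "\<bar>w $ j\<bar>"] by (simp add: abs_mult)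
    then show "norm (w $ i * w $ j) \<le> norm ((w $ i)\<^sup>2 + (w $ j)\<^sup>2)"
      by simp
  qed
qed measurable

lemma integral_std_gaussian_mult [simp]:
  "(\<integral>(w::real ^ 'n). w $ i * w $ j \<partial>std_gaussian) = (if i = j then 1 else 0)"
proof (cases "i = j")
  case True
  have "(\<integral>(w::real ^ 'n). (w $ i)\<^sup>2 \<partial>std_gaussian) = 1"
    using std_normal_distribution_even_moments(1)[of 1]
    unfolding distr_std_gaussian_nth[of i, symmetric]
    by (subst (asm) integral_distr) auto
  then show ?thesis
    using True by (simp add: power2_eq_square)
next
  case False
  let ?f = "\<lambda>w::real ^ 'n. \<chi> k. if k = i then - w $ k else w $ k"
  have [measurable]: "?f \<in> borel_measurable borel"
    by measurable
  have "linear ?f"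
    by (rule linearI) (auto simp: vec_eq_iff)
  moreover have "norm (?f w) = norm w" for w
  proof -
    have "?f w \<bullet> ?f w = w \<bullet> w"
      by (auto simp: inner_vec_def intro!: sum.cong)
    then show ?thesis by (simp add: norm_eq_sqrt_inner)
  qed
  ultimately have f: "orthogonal_transformation ?f"
    by (simp add: orthogonal_transformation)
  have "(\<integral>(w::real ^ 'n). w $ i * w $ j \<partial>std_gaussian) = (\<integral>(w::real ^ 'n). w $ i * w $ j \<partial>distr std_gaussian borel ?f)"
    by (simp add: distr_std_gaussian_orthogonal_transformation[OF f])
  also have "\<dots> = (\<integral>(w::real ^ 'n). - (w $ i * w $ j) \<partial>std_gaussian)"
    using False by (subst integral_distr) auto
  finally show ?thesis
    using False by simp
qed

subsection \<open>Gram matrices and Gaussian vectors\<close>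

declare transpose_matrix_vector [simp del]

lemma transpose_diff: "transpose (A - B) = transpose A - transpose (B :: 'a::ab_group_add ^ 'n ^ 'm)"
  by (simp add: transpose_def vec_eq_iff)

lemma matrix_diff_ldistrib: "A ** (B - C) = A ** B - A ** (C :: real ^ 'n ^ 'm)"
  by (simp add: matrix_matrix_mult_def vec_eq_iff algebra_simps sum_subtractf)

lemma matrix_diff_rdistrib: "(A - B) ** C = A ** C - B ** (C :: real ^ 'n ^ 'm)"
  by (simp add: matrix_matrix_mult_def vec_eq_iff algebra_simps sum_subtractf)

lemma inner_matrix_vector_mult_left:
  fixes A :: "real ^ 'n ^ 'm"
  shows "(A *v x) \<bullet> y = x \<bullet> (transpose A *v y)"
  using dot_lmul_matrix[of x "transpose A" y] by simp

lemma matrix_mult_transpose_inner: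
  fixes K :: "real ^ 'm ^ 'n"
  shows "x \<bullet> ((K ** transpose K) *v y) = (transpose K *v x) \<bullet> (transpose K *v y)"
  by (simp add: inner_matrix_vector_mult_left flip: matrix_vector_mul_assoc)

lemma gram_factor:
  fixes K :: "real ^ 'm ^ 'n"
  assumes inv: "invertible (K ** transpose K)"
  obtains C :: "real ^ 'n ^ 'n" where "C ** transpose C = K ** transpose K"
proof -
  let ?k = "\<lambda>x. transpose K *v x"
  let ?T = "range ?k"
  have lin: "linear ?k" by simp
  have "inj ?k"
  proof (rule injI)
    fix x y assume "transpose K *v x = transpose K *v y"
    then have "(K ** transpose K) *v x = (K ** transpose K) *v y"
      by (simp flip: matrix_vector_mul_assoc)
    then show "x = y"
      using inv unfolding invertible_def by (metis matrix_vector_mul_assoc matrix_vector_mul_lid)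
  qed
  then have d: "dim ?T = dim (UNIV :: (real ^ 'n) set)"
    by (intro dim_image_eq lin) (auto simp: inj_on_def)
  have T: "subspace ?T"
    using lin by (simp add: linear_subspace_image)
  obtain g :: "real ^ 'm \<Rightarrow> real ^ 'n" where g: "linear g" "\<And>x. x \<in> ?T \<Longrightarrow> norm (g x) = norm x"
    by (rule isometries_subspaces[OF subspace_UNIV T d[symmetric]]) blast
  have ginner: "g x \<bullet> g y = x \<bullet> y" if "x \<in> ?T" "y \<in> ?T" for x y
  proof -
    have "x + y \<in> ?T" using T that by (rule subspace_add)
    then have "(norm (g x + g y))\<^sup>2 = (norm (x + y))\<^sup>2"
      using g(2)[of "x + y"] g(1) by (simp add: linear_add)
    then show ?thesis
      using g(2)[OF that(1)] g(2)[OF that(2)] by (simp add: dot_norm)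
  qed
  define C where "C = transpose (matrix (g \<circ> ?k))"
  have C: "transpose C *v x = g (?k x)" for x
    using linear_compose[OF lin g(1)] unfolding C_def transpose_transpose by (simp add: matrix_works)
  have "(C ** transpose C) *v y = (K ** transpose K) *v y" for y
  proof (rule vector_eq_rdot[THEN iffD1], rule allI)
    fix x
    show "((C ** transpose C) *v y) \<bullet> x = ((K ** transpose K) *v y) \<bullet> x"
      unfolding inner_commute[of _ x] matrix_mult_transpose_inner C by (rule ginner) auto
  qed
  then have "C ** transpose C = K ** transpose K"
    by (simp add: matrix_eq)
  then show thesis by (rule that)
qed

lemma invertible_matrix_inv:
  fixes A :: "real ^ 'n ^ 'n"
  assumes "invertible A"
  shows "A ** matrix_inv A = mat 1" "matrix_inv A ** A = mat 1"
proof -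
  have "A ** matrix_inv A = mat 1 \<and> matrix_inv A ** A = mat 1"
    using assms unfolding invertible_def matrix_inv_def by (rule someI_ex)
  then show "A ** matrix_inv A = mat 1" "matrix_inv A ** A = mat 1" by auto
qed

lemma invertible_gram_factor:
  fixes C :: "real ^ 'n ^ 'n"
  assumes "invertible (C ** transpose C)"
  shows "invertible C"
  using assms by (simp add: invertible_det_nz det_mul)

definition vblock :: "real ^ 'm ^ 'k \<Rightarrow> real ^ 'm ^ 'l \<Rightarrow> real ^ 'm ^ ('k + 'l)" where
  "vblock A B = (\<chi> s. case s of Inl i \<Rightarrow> A $ i | Inr j \<Rightarrow> B $ j)"

lemma vblock_mult_vec: "vblock A B *v x = join_vec (A *v x, B *v x)"
  by (simp add: vblock_def join_vec_def matrix_vector_mult_def vec_eq_iff split: sum.split)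

lemma vblock_mult_transpose:
  assumes "A ** transpose A = mat 1" "B ** transpose B = mat 1" "A ** transpose B = 0"
  shows "vblock A B ** transpose (vblock A B) = mat 1"
proof -
  have "B ** transpose A = transpose (A ** transpose B)"
    by (simp add: matrix_transpose_mul)
  then have "B ** transpose A = 0"
    by (simp only: assms) (simp add: transpose_def vec_eq_iff)
  then show ?thesis
    using assms unfolding vec_eq_iff
    by (auto simp: matrix_matrix_mult_def transpose_def vblock_def mat_def split: sum.splits)
qed

lemma gram_factor_coisometry:
  fixes C :: "real ^ 'n ^ 'n" and K :: "real ^ 'm ^ 'n"
  assumes "C ** transpose C = K ** transpose K" and "C' ** C = mat 1"
  shows "(C' ** K) ** transpose (C' ** K) = mat 1"
proof -
  have "(C' ** K) ** transpose (C' ** K) = C' ** (K ** transpose K) ** transpose C'"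
    by (simp add: matrix_transpose_mul matrix_mul_assoc)
  also have "\<dots> = (C' ** C) ** transpose (C' ** C)"
    by (simp add: matrix_transpose_mul matrix_mul_assoc flip: assms)
  finally show ?thesis by (simp add: assms)
qed

lemma distr_std_gaussian_pair:
  fixes K :: "real ^ 'm ^ 'k" and L :: "real ^ 'm ^ 'l"
  assumes inv: "invertible (K ** transpose K)" "invertible (L ** transpose L)"
    and KL: "K ** transpose L = 0"
  obtains C :: "real ^ 'k ^ 'k" and D :: "real ^ 'l ^ 'l" where "C ** transpose C = K ** transpose K" "D ** transpose D = L ** transpose L"
    "distr std_gaussian (borel \<Otimes>\<^sub>M borel) (\<lambda>w. (K *v w, L *v w))
      = distr (std_gaussian \<Otimes>\<^sub>M std_gaussian) (borel \<Otimes>\<^sub>M borel) (\<lambda>(a, b). (C *v a, D *v b))"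
proof -
  obtain C :: "real ^ 'k ^ 'k" where C: "C ** transpose C = K ** transpose K" using gram_factor[OF inv(1)] .
  obtain D :: "real ^ 'l ^ 'l" where D: "D ** transpose D = L ** transpose L" using gram_factor[OF inv(2)] .
  obtain C' where C': "C ** C' = mat 1" "C' ** C = mat 1"
    using invertible_gram_factor[of C] inv C by (auto simp: invertible_def)
  obtain D' where D': "D ** D' = mat 1" "D' ** D = mat 1"
    using invertible_gram_factor[of D] inv D by (auto simp: invertible_def)
  let ?Q = "vblock (C' ** K) (D' ** L)"
  have "(C' ** K) ** transpose (D' ** L) = C' ** (K ** transpose L) ** transpose D'"
    by (simp add: matrix_transpose_mul matrix_mul_assoc)
  then have "(C' ** K) ** transpose (D' ** L) = 0"
    by (simp add: KL)
  then have "?Q ** transpose ?Q = mat 1"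
    by (intro vblock_mult_transpose gram_factor_coisometry[OF C C'(2)] gram_factor_coisometry[OF D D'(2)])
  from distr_std_gaussian_coisometry[OF this]
  have "std_gaussian \<Otimes>\<^sub>M std_gaussian
      = distr (distr std_gaussian borel (\<lambda>w. ?Q *v w)) (borel \<Otimes>\<^sub>M borel) (\<lambda>v. (subvec Inl v, subvec Inr v))"
    by (simp add: distr_std_gaussian_split)
  also have "\<dots> = distr std_gaussian (borel \<Otimes>\<^sub>M borel) (\<lambda>w. ((C' ** K) *v w, (D' ** L) *v w))"
    by (subst distr_distr) (auto simp: o_def vblock_mult_vec)
  finally have "distr (std_gaussian \<Otimes>\<^sub>M std_gaussian) (borel \<Otimes>\<^sub>M borel) (\<lambda>(a, b). (C *v a, D *v b))
      = distr std_gaussian (borel \<Otimes>\<^sub>M borel) (\<lambda>w. (C *v ((C' ** K) *v w), D *v ((D' ** L) *v w)))"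
    by (simp only:, subst distr_distr) (auto simp: o_def)
  also have "\<dots> = distr std_gaussian (borel \<Otimes>\<^sub>M borel) (\<lambda>w. (K *v w, L *v w))"
    by (simp add: matrix_vector_mul_assoc matrix_mul_assoc C' D')
  finally show thesis
    by (intro that[OF C D]) simp
qed

definition affine_density :: "real ^ 'n \<Rightarrow> real ^ 'n ^ 'n \<Rightarrow> real ^ 'n \<Rightarrow> real" where
  "affine_density r C x = (\<Prod>i\<in>UNIV. std_normal_density ((matrix_inv C *v (x - r)) $ i)) / \<bar>det C\<bar>"

lemma measurable_affine_density [measurable (raw)]:
  assumes [measurable]: "f \<in> borel_measurable M"
  shows "(\<lambda>x. affine_density r C (f x)) \<in> borel_measurable M"
  unfolding affine_density_def by measurable

lemma affine_density_pos: "invertible C \<Longrightarrow> affine_density r C x > 0"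
  unfolding affine_density_def
  by (intro divide_pos_pos prod_pos normal_density_pos) (auto simp: invertible_det_nz)

lemma distr_std_gaussian_affine:
  fixes C :: "real ^ 'n ^ 'n"
  assumes C: "invertible C"
  shows "distr std_gaussian borel (\<lambda>w. r + C *v w) = density lborel (affine_density r C)"
proof -
  let ?C' = "matrix_inv C"
  let ?d = "\<bar>det C\<bar>"
  have d: "?d > 0" using C by (simp add: invertible_det_nz)
  have "lborel = density (distr lborel borel (\<lambda>w. C *v w)) (\<lambda>_. ?d)"
    using lborel_linear_image[of "\<lambda>w. C *v w"] d by simp
  moreover have "lborel = distr lborel borel (\<lambda>x::real ^ 'n. r + x)"
    using lborel_affine[of 1 r] by (simp add: density_1)
  ultimately have "lborel = distr (density (distr lborel borel (\<lambda>w. C *v w)) (\<lambda>_. ?d)) borel (\<lambda>x. r + x)"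
    by simp
  also have "\<dots> = density (distr lborel borel (\<lambda>w. r + C *v w)) (\<lambda>_. ?d)"
    by (subst density_distr[symmetric]) (auto simp: distr_distr o_def)
  finally have lb: "lborel = \<dots>" .
  have "density lborel (affine_density r C)
      = density (density (distr lborel borel (\<lambda>w. r + C *v w)) (\<lambda>_. ?d)) (affine_density r C)"
    by (simp only: lb[symmetric])
  also have "\<dots> = density (distr lborel borel (\<lambda>w. r + C *v w)) (\<lambda>x. ?d * affine_density r C x)"
    by (subst density_density_eq) (auto simp: ennreal_mult')
  also have "\<dots> = distr (density lborel (\<lambda>w. ?d * affine_density r C (r + C *v w))) borel (\<lambda>w. r + C *v w)"
    by (subst density_distr) auto
  also have "density lborel (\<lambda>w. ?d * affine_density r C (r + C *v w)) = std_gaussian"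
    using d by (simp add: std_gaussian_def affine_density_def matrix_vector_mul_assoc invertible_matrix_inv[OF C])
  finally show ?thesis by simp
qed

subsection \<open>Conditional entropy of Gaussian vectors\<close>

lemma distr_lborel_pair_shear:
  fixes g :: "'b::euclidean_space \<Rightarrow> 'a::euclidean_space"
  assumes [measurable]: "g \<in> borel_measurable borel"
  shows "distr (lborel \<Otimes>\<^sub>M lborel) (lborel \<Otimes>\<^sub>M lborel) (\<lambda>(x, y). (x + g y, y)) = lborel \<Otimes>\<^sub>M lborel"
    (is "distr ?L _ ?H = _")
proof (rule measure_eqI)
  fix S assume "S \<in> sets (distr ?L ?L ?H)"
  then have [measurable]: "S \<in> sets ?L" by simp
  have [measurable]: "?H \<in> ?L \<rightarrow>\<^sub>M ?L" by measurable
  have transl: "(\<integral>\<^sup>+x. f (x + c) \<partial>lborel) = (\<integral>\<^sup>+x. f x \<partial>lborel)"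
    if [measurable]: "f \<in> borel_measurable borel" for f :: "'a \<Rightarrow> ennreal" and c
  proof -
    have "lborel = distr lborel borel (\<lambda>x::'a. c + x)"
      using lborel_affine[of 1 c] by (simp add: density_1)
    then have "(\<integral>\<^sup>+x. f x \<partial>lborel) = (\<integral>\<^sup>+x. f x \<partial>distr lborel borel (\<lambda>x. c + x))"
      by metis
    then show ?thesis
      by (simp add: nn_integral_distr add.commute)
  qed
  have "emeasure (distr ?L ?L ?H) S = (\<integral>\<^sup>+p. indicator S p \<partial>distr ?L ?L ?H)"
    using \<open>S \<in> sets ?L\<close> by simp
  also have "\<dots> = (\<integral>\<^sup>+p. indicator S (?H p) \<partial>?L)"
    by (rule nn_integral_distr) auto
  also have "\<dots> = (\<integral>\<^sup>+y. \<integral>\<^sup>+x. indicator S (x + g y, y) \<partial>lborel \<partial>lborel)"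
    by (subst lborel_pair.nn_integral_snd[symmetric]) auto
  also have "\<dots> = (\<integral>\<^sup>+y. \<integral>\<^sup>+x. indicator S (x, y) \<partial>lborel \<partial>lborel)"
    by (intro nn_integral_cong transl[of "\<lambda>x. indicator S (x, _)"]) measurable
  also have "\<dots> = emeasure ?L S"
    using \<open>S \<in> sets ?L\<close> by (subst lborel_pair.nn_integral_snd) auto
  finally show "emeasure (distr ?L ?L ?H) S = emeasure ?L S" .
qed simp

lemma density_std_gaussian_pair_shear:
  fixes C :: "real ^ 'k ^ 'k" and D :: "real ^ 'l ^ 'l" and G :: "real ^ 'l ^ 'k"
  assumes C: "invertible C" and D: "invertible D"
  shows "distr (std_gaussian \<Otimes>\<^sub>M std_gaussian) (lborel \<Otimes>\<^sub>M lborel)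
      (\<lambda>(a, b). (r + C *v a + G *v (v + D *v b), v + D *v b))
    = density (lborel \<Otimes>\<^sub>M lborel) (\<lambda>(x, y). affine_density r C (x - G *v y) * affine_density v D y)"
proof -
  interpret std_l: prob_space "std_gaussian :: (real ^ 'l) measure"
    by (rule prob_space_std_gaussian)
  let ?L = "lborel \<Otimes>\<^sub>M lborel :: ((real ^ 'k) \<times> (real ^ 'l)) measure"
  let ?p = "\<lambda>x y. affine_density r C (x - G *v y) * affine_density v D y"
  let ?H = "\<lambda>(x, y). (x + G *v y, y)"
  let ?NC = "distr std_gaussian borel (\<lambda>a. r + C *v a)"
  let ?ND = "distr std_gaussian borel (\<lambda>b. v + D *v b)"
  have nn: "affine_density r C x \<ge> 0" for x
    using affine_density_pos[OF C, of r x] by simp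
  have pND: "prob_space ?ND"
    by (rule std_l.prob_space_distr) measurable
  have [measurable]: "(\<lambda>(x, y). ennreal (?p x y)) \<in> borel_measurable ?L"
    by measurable
  have "distr (std_gaussian \<Otimes>\<^sub>M std_gaussian) ?L (\<lambda>(a, b). (r + C *v a + G *v (v + D *v b), v + D *v b))
    = distr (distr (std_gaussian \<Otimes>\<^sub>M std_gaussian) (borel \<Otimes>\<^sub>M borel) (\<lambda>(a, b). (r + C *v a, v + D *v b))) ?L ?H"
    by (subst distr_distr) (auto simp: o_def split_beta')
  also have "distr (std_gaussian \<Otimes>\<^sub>M std_gaussian) (borel \<Otimes>\<^sub>M borel) (\<lambda>(a, b). (r + C *v a, v + D *v b)) = ?NC \<Otimes>\<^sub>M ?ND"
    by (subst pair_measure_distr) (auto intro: prob_space_imp_sigma_finite[OF pND])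
  also have "\<dots> = density ?L (\<lambda>(x, y). ennreal (affine_density r C x) * ennreal (affine_density v D y))"
    using prob_space_imp_sigma_finite[OF pND]
    unfolding distr_std_gaussian_affine[OF C] distr_std_gaussian_affine[OF D]
    by (intro pair_measure_density) (auto simp: lborel.sigma_finite_measure_axioms)
  also have "\<dots> = density ?L (\<lambda>p. (\<lambda>(x, y). ennreal (?p x y)) (?H p))"
    by (simp add: split_beta' ennreal_mult' nn)
  also have "distr \<dots> ?L ?H = density (distr ?L ?L ?H) (\<lambda>(x, y). ennreal (?p x y))"
    by (rule density_distr[symmetric]) auto
  finally show ?thesis
    using distr_lborel_pair_shear[of "\<lambda>y. G *v y"] by (simp add: split_beta')
qed

lemma conditional_entropy_std_gaussian_pair:
  fixes C :: "real ^ 'k ^ 'k" and D :: "real ^ 'l ^ 'l" and G :: "real ^ 'l ^ 'k"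
  assumes M: "prob_space M" and b: "b > 1"
    and C: "invertible C" and D: "invertible D"
    and U [measurable]: "U \<in> borel_measurable M" and V [measurable]: "V \<in> borel_measurable M"
    and UV: "distr M (borel \<Otimes>\<^sub>M borel) (\<lambda>\<omega>. (U \<omega>, V \<omega>)) = distr (std_gaussian \<Otimes>\<^sub>M std_gaussian) (borel \<Otimes>\<^sub>M borel)
      (\<lambda>(x, y). (r + C *v x + G *v (v + D *v y), v + D *v y))"
  shows "diff_cond_entropy M b U V = log b \<bar>det C\<bar>
    - (\<integral>(w::real ^ 'k). log b (\<Prod>i\<in>UNIV. std_normal_density (w $ i)) \<partial>std_gaussian)"
proof -
  interpret information_space M b
    using M b by (simp add: information_space_def information_space_axioms_def)
  interpret std_k: prob_space "std_gaussian :: (real ^ 'k) measure"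
    by (rule prob_space_std_gaussian)
  let ?L = "lborel \<Otimes>\<^sub>M lborel :: ((real ^ 'k) \<times> (real ^ 'l)) measure"
  let ?p = "\<lambda>(x, y). affine_density r C (x - G *v y) * affine_density v D y"
  let ?T = "\<lambda>(x, y). (r + C *v x + G *v (v + D *v y), v + D *v y)"
  let ?\<phi> = "\<lambda>w::real ^ 'k. \<Prod>i\<in>UNIV. std_normal_density (w $ i)"
  have pos: "affine_density r C x > 0" "affine_density v D y > 0" for x y
    using affine_density_pos C D by auto
  have nn: "?p q \<ge> 0" for q
    using pos by (auto simp: split_beta less_imp_le)
  have mp [measurable]: "?p \<in> borel_measurable ?L"
    by measurable
  have distr_UV: "distr M ?L (\<lambda>\<omega>. (U \<omega>, V \<omega>)) = distr (std_gaussian \<Otimes>\<^sub>M std_gaussian) ?L ?T"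
  proof -
    have "distr M ?L (\<lambda>\<omega>. (U \<omega>, V \<omega>)) = distr M (borel \<Otimes>\<^sub>M borel) (\<lambda>\<omega>. (U \<omega>, V \<omega>))"
      by (rule distr_cong) (auto cong: sets_pair_measure_cong)
    also have "\<dots> = distr (std_gaussian \<Otimes>\<^sub>M std_gaussian) ?L ?T"
      unfolding UV by (rule distr_cong) (auto cong: sets_pair_measure_cong)
    finally show ?thesis .
  qed
  also have "\<dots> = density ?L ?p"
    using density_std_gaussian_pair_shear[OF C D, of r G v] by (simp add: split_beta')
  finally have dUV: "distributed M ?L (\<lambda>\<omega>. (U \<omega>, V \<omega>)) ?p"
    by (simp add: distributed_def)
  have dV: "distributed M lborel V (affine_density v D)"
  proof -
    have "distr M lborel V = distr (distr M ?L (\<lambda>\<omega>. (U \<omega>, V \<omega>))) borel snd"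
      by (subst distr_distr) (auto simp: o_def intro!: distr_cong)
    also have "\<dots> = distr (distr ((std_gaussian :: (real ^ 'k) measure) \<Otimes>\<^sub>M std_gaussian) borel snd) borel (\<lambda>y. v + D *v y)"
      unfolding distr_UV by (subst (1 2) distr_distr) (auto simp: o_def split_beta')
    also have "distr (std_gaussian \<Otimes>\<^sub>M std_gaussian) borel (snd :: (real ^ 'k) \<times> (real ^ 'l) \<Rightarrow> _) = std_gaussian"
      unfolding distr_std_gaussian_split[symmetric]
      by (subst distr_distr) (auto simp: o_def distr_std_gaussian_subvec_Inr)
    finally show ?thesis
      by (simp add: distributed_def distr_std_gaussian_affine[OF D])
  qed
  have fst_std: "distr (std_gaussian \<Otimes>\<^sub>M std_gaussian) borel (fst :: (real ^ 'k) \<times> (real ^ 'l) \<Rightarrow> _) = std_gaussian"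
    unfolding distr_std_gaussian_split[symmetric]
    by (subst distr_distr) (auto simp: o_def distr_std_gaussian_subvec_Inl)
  have int: "integrable std_gaussian (\<lambda>w. log b (?\<phi> w))"
  proof -
    have "log b (?\<phi> w) = CARD('k) * log b (1 / sqrt (2 * pi)) - (\<Sum>i\<in>UNIV. (w $ i)\<^sup>2) / (2 * ln b)" for w
    proof -
      have "(norm w)\<^sup>2 = (\<Sum>i\<in>UNIV. (w $ i)\<^sup>2)"
        unfolding power2_norm_eq_inner by (simp add: inner_vec_def power2_eq_square)
      then show ?thesis
        unfolding prod_std_normal_density using b
        by (subst log_mult) (auto simp: log_nat_power log_def[of b "exp _"])
    qed
    then show ?thesis
      by (simp add: integrable_std_gaussian_nth_square)
  qed
  have "diff_cond_entropy M b U V = - (\<integral>q. ?p q * log b (?p q / affine_density v D (snd q)) \<partial>?L)"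
    unfolding diff_cond_entropy_def
    by (subst conditional_entropy_generic_eq[OF _ _ dV _ dUV])
      (use nn pos in \<open>auto simp: split_beta' less_imp_le lborel.sigma_finite_measure_axioms\<close>)
  also have "(\<lambda>q. ?p q * log b (?p q / affine_density v D (snd q)))
      = (\<lambda>q. ?p q * log b (affine_density r C (fst q - G *v snd q)))"
    using pos by (auto simp: fun_eq_iff less_imp_neq[symmetric] split_beta')
  also have "(\<integral>q. ?p q * log b (affine_density r C (fst q - G *v snd q)) \<partial>?L)
      = (\<integral>q. log b (affine_density r C (fst q - G *v snd q)) \<partial>density ?L ?p)"
    using nn by (subst integral_real_density) auto
  also have "density ?L ?p = distr (std_gaussian \<Otimes>\<^sub>M std_gaussian) ?L ?T"
    using dUV distr_UV by (simp add: distributed_def)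
  also have "(\<integral>q. log b (affine_density r C (fst q - G *v snd q)) \<partial>distr (std_gaussian \<Otimes>\<^sub>M std_gaussian) ?L ?T)
      = (\<integral>q. log b (affine_density r C (r + C *v fst q)) \<partial>((std_gaussian :: (real ^ 'k) measure) \<Otimes>\<^sub>M (std_gaussian :: (real ^ 'l) measure)))"
    by (subst integral_distr) (auto simp: split_beta')
  also have "\<dots> = (\<integral>w. log b (affine_density r C (r + C *v w)) \<partial>distr (std_gaussian \<Otimes>\<^sub>M (std_gaussian :: (real ^ 'l) measure)) borel fst)"
    by (subst integral_distr) auto
  also have "\<dots> = (\<integral>w. log b (?\<phi> w) - log b \<bar>det C\<bar> \<partial>std_gaussian)"
  proof -
    have "affine_density r C (r + C *v w) = ?\<phi> w / \<bar>det C\<bar>" for w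
      by (simp add: affine_density_def matrix_vector_mul_assoc invertible_matrix_inv[OF C])
    moreover have "?\<phi> w > 0" for w
      by (intro prod_pos) (auto intro: normal_density_pos)
    moreover have "\<bar>det C\<bar> > 0"
      using C by (simp add: invertible_det_nz)
    ultimately have "log b (affine_density r C (r + C *v w)) = log b (?\<phi> w) - log b \<bar>det C\<bar>" for w
      by (simp only:) (rule log_divide_pos)
    then show ?thesis
      by (simp only: fst_std)
  qed
  also have "\<dots> = (\<integral>w. log b (?\<phi> w) \<partial>std_gaussian) - log b \<bar>det C\<bar>"
    using int by (simp add: std_k.prob_space[simplified])
  finally show ?thesis by simp
qed

lemma distr_std_gaussian_gram:
  fixes C :: "real ^ 'n ^ 'n" and K :: "real ^ 'm ^ 'n"
  assumes inv: "invertible (K ** transpose K)" and CK: "C ** transpose C = K ** transpose K"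
  shows "distr std_gaussian borel (\<lambda>w. K *v w) = distr std_gaussian borel (\<lambda>w. C *v w)"
proof -
  obtain C' where C': "C ** C' = mat 1" "C' ** C = mat 1"
    using invertible_gram_factor[of C] inv CK by (auto simp: invertible_def)
  have "distr std_gaussian borel (\<lambda>w. C *v w) = distr (distr std_gaussian borel (\<lambda>w. (C' ** K) *v w)) borel (\<lambda>w. C *v w)"
    by (simp add: distr_std_gaussian_coisometry gram_factor_coisometry[OF CK C'(2)])
  also have "\<dots> = distr std_gaussian borel (\<lambda>w. K *v w)"
    by (subst distr_distr) (auto simp: o_def matrix_vector_mul_assoc matrix_mul_assoc C')
  finally show ?thesis by simp
qed

definition hblock :: "real ^ 'm ^ 'k \<Rightarrow> real ^ 'n ^ 'k \<Rightarrow> real ^ ('m + 'n) ^ 'k" where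
  "hblock A B = (\<chi> i. join_vec (A $ i, B $ i))"

lemma hblock_mult_vec: "hblock A B *v x = A *v subvec Inl x + B *v subvec Inr x"
  by (simp add: hblock_def matrix_vector_mult_def subvec_def sum_UNIV_sum vec_eq_iff)

lemma hblock_mult_transpose:
  "hblock A B ** transpose (hblock C D) = A ** transpose C + B ** transpose D"
  by (simp add: hblock_def matrix_matrix_mult_def transpose_def sum_UNIV_sum vec_eq_iff)

lemma invertible_gram_plus_scalar:
  fixes X :: "real ^ 'm ^ 'k"
  assumes "\<sigma> \<noteq> 0"
  shows "invertible (X ** transpose X + \<sigma>\<^sup>2 *\<^sub>R mat 1)"
proof -
  have "x = 0" if "(X ** transpose X + \<sigma>\<^sup>2 *\<^sub>R mat 1) *v x = 0" for x
  proof -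
    have "x \<bullet> ((X ** transpose X + \<sigma>\<^sup>2 *\<^sub>R mat 1) *v x)
        = (transpose X *v x) \<bullet> (transpose X *v x) + \<sigma>\<^sup>2 * (x \<bullet> x)"
      by (simp add: matrix_vector_mult_add_rdistrib inner_add_right matrix_mult_transpose_inner
          flip: scaleR_matrix_vector_assoc)
    then have "\<sigma>\<^sup>2 * (x \<bullet> x) \<le> 0"
      using that by (smt (verit) inner_ge_zero inner_zero_right)
    then have "x \<bullet> x \<le> 0"
      using assms by (simp add: mult_le_0_iff)
    then have "x \<bullet> x = 0"
      using inner_ge_zero[of x] by linarith
    then show "x = 0" by simp
  qed
  then show ?thesis
    by (simp add: invertible_left_inverse matrix_left_invertible_ker)
qed

lemma det_gram:
  fixes C :: "real ^ 'k ^ 'k"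
  shows "det (C ** transpose C) = (det C)\<^sup>2"
  by (simp add: det_mul power2_eq_square)

lemma cov_matrix_affine_std_gaussian:
  fixes X :: "'a \<Rightarrow> real ^ 'n" and B :: "real ^ 'm ^ 'n"
  assumes [measurable]: "X \<in> borel_measurable M"
    and X: "distr M borel X = distr std_gaussian borel (\<lambda>w. \<mu> + B *v w)"
  shows "(\<integral>\<omega>. X \<omega> $ i \<partial>M) = \<mu> $ i" and "cov_matrix M X = B ** transpose B"
proof -
  interpret std: prob_space "std_gaussian :: (real ^ 'm) measure"
    by (rule prob_space_std_gaussian)
  have transfer: "(\<integral>\<omega>. f (X \<omega>) \<partial>M) = (\<integral>w. f (\<mu> + B *v w) \<partial>std_gaussian)"
    if [measurable]: "f \<in> borel_measurable borel" for f :: "real ^ 'n \<Rightarrow> real"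
    by (subst integral_distr[of X M borel f, symmetric], measurable)
      (simp add: X integral_distr)
  have mean: "(\<integral>\<omega>. X \<omega> $ i \<partial>M) = \<mu> $ i" for i
  proof -
    have "(\<integral>\<omega>. X \<omega> $ i \<partial>M) = (\<integral>w. \<mu> $ i + (\<Sum>j\<in>UNIV. B $ i $ j * w $ j) \<partial>std_gaussian)"
      by (subst transfer) (auto simp: matrix_vector_mult_def)
    also have "\<dots> = \<mu> $ i"
      by (subst Bochner_Integration.integral_add) (auto simp: std.prob_space[simplified])
    finally show ?thesis .
  qed
  show "(\<integral>\<omega>. X \<omega> $ i \<partial>M) = \<mu> $ i" by (rule mean)
  have "(\<integral>\<omega>. (X \<omega> $ i - \<mu> $ i) * (X \<omega> $ j - \<mu> $ j) \<partial>M) = (B ** transpose B) $ i $ j" for i j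
  proof -
    have "(\<integral>\<omega>. (X \<omega> $ i - \<mu> $ i) * (X \<omega> $ j - \<mu> $ j) \<partial>M)
        = (\<integral>w. (\<Sum>k\<in>UNIV. \<Sum>l\<in>UNIV. B $ i $ k * B $ j $ l * (w $ k * w $ l)) \<partial>std_gaussian)"
      by (subst transfer[of "\<lambda>x. (x $ i - \<mu> $ i) * (x $ j - \<mu> $ j)"])
        (auto simp: matrix_vector_mult_def sum_product ac_simps)
    also have "\<dots> = (\<Sum>k\<in>UNIV. \<Sum>l\<in>UNIV. B $ i $ k * B $ j $ l * (if k = l then 1 else 0))"
      by (subst Bochner_Integration.integral_sum; simp)
    also have "\<dots> = (B ** transpose B) $ i $ j"
      by (simp add: matrix_matrix_mult_def transpose_def if_distrib cong: if_cong)
    finally show ?thesis .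
  qed
  then show "cov_matrix M X = B ** transpose B"
    by (simp add: cov_matrix_def mean vec_eq_iff)
qed

lemma gaussian_vector_std:
  fixes X :: "'a \<Rightarrow> real ^ 'n"
  assumes "gaussian_vector M X" and "\<And>i. (\<integral>\<omega>. X \<omega> $ i \<partial>M) = 0" and "cov_matrix M X = mat 1"
  shows "distr M borel X = std_gaussian"
proof -
  obtain \<mu> and B :: "real ^ 'n ^ 'n" where X: "X \<in> borel_measurable M"
    "distr M borel X = distr std_gaussian borel (\<lambda>w. \<mu> + B *v w)"
    using assms(1) by (auto simp: gaussian_vector_def)
  have "\<mu> = 0" "B ** transpose B = mat 1"
    using cov_matrix_affine_std_gaussian[OF X] assms by (auto simp: vec_eq_iff)
  then show ?thesis
    by (simp add: X distr_std_gaussian_coisometry)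
qed

lemma distr_indep_affine_std_gaussian:
  fixes X W :: "'a \<Rightarrow> real ^ 'n" and B :: "real ^ 'n ^ 'n"
  assumes M: "prob_space M"
    and X: "distr M borel X = distr std_gaussian borel (\<lambda>w. \<mu> + B *v w)"
    and W: "distr M borel W = std_gaussian"
    and indep: "prob_space.indep_var M borel X borel W"
  shows "distr M (borel \<Otimes>\<^sub>M borel) (\<lambda>\<omega>. (X \<omega>, W \<omega>))
    = distr (std_gaussian :: (real ^ ('n + 'n)) measure) (borel \<Otimes>\<^sub>M borel)
        (\<lambda>w. (\<mu> + B *v subvec Inl w, subvec Inr w))"
proof -
  interpret prob_space M by fact
  interpret std: prob_space "std_gaussian :: (real ^ 'n) measure"
    by (rule prob_space_std_gaussian)
  have id: "distr std_gaussian borel (\<lambda>w::real ^ 'n. w) = std_gaussian"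
    by (rule distr_id2) simp
  have "distr M (borel \<Otimes>\<^sub>M borel) (\<lambda>\<omega>. (X \<omega>, W \<omega>))
      = distr std_gaussian borel (\<lambda>w. \<mu> + B *v w) \<Otimes>\<^sub>M distr std_gaussian borel (\<lambda>w. w)"
    using indep by (simp add: indep_var_distribution_eq X W id)
  also have "\<dots> = distr (std_gaussian \<Otimes>\<^sub>M std_gaussian) (borel \<Otimes>\<^sub>M borel) (\<lambda>(v, w). (\<mu> + B *v v, w))"
    by (rule pair_measure_distr) (auto simp: id std.sigma_finite_measure_axioms)
  also have "\<dots> = distr (std_gaussian :: (real ^ ('n + 'n)) measure) (borel \<Otimes>\<^sub>M borel)
        (\<lambda>w. (\<mu> + B *v subvec Inl w, subvec Inr w))"
    unfolding distr_std_gaussian_split[symmetric]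
    by (subst distr_distr) (auto simp: o_def)
  finally show ?thesis .
qed

lemma linear_step_affine_std_gaussian:
  fixes X W :: "'a \<Rightarrow> real ^ 'n" and B A :: "real ^ 'n ^ 'n"
  assumes M: "prob_space M"
    and X: "distr M borel X = distr std_gaussian borel (\<lambda>w. \<mu> + B *v w)"
    and W: "distr M borel W = std_gaussian"
    and indep: "prob_space.indep_var M borel X borel W"
    and \<sigma>: "\<sigma> \<noteq> 0"
  obtains C :: "real ^ 'n ^ 'n" where "distr M borel (\<lambda>\<omega>. linear_step A \<sigma> (X \<omega>) (W \<omega>))
    = distr std_gaussian borel (\<lambda>w. A *v \<mu> + C *v w)"
proof -
  interpret prob_space M by fact
  have [measurable]: "X \<in> borel_measurable M" "W \<in> borel_measurable M"
    using indep by (auto simp: indep_var_distribution_eq)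
  let ?K = "hblock (A ** B) (\<sigma> *\<^sub>R mat 1)"
  have "?K ** transpose ?K = (A ** B) ** transpose (A ** B) + \<sigma>\<^sup>2 *\<^sub>R mat 1"
    by (simp add: hblock_mult_transpose transpose_scalar matrix_scalar_ac power2_eq_square
        flip: scalar_matrix_assoc)
  then have inv: "invertible (?K ** transpose ?K)"
    using invertible_gram_plus_scalar[OF \<sigma>] by simp
  obtain C :: "real ^ 'n ^ 'n" where C: "C ** transpose C = ?K ** transpose ?K"
    using gram_factor[OF inv] .
  have "distr M borel (\<lambda>\<omega>. linear_step A \<sigma> (X \<omega>) (W \<omega>))
      = distr (distr M (borel \<Otimes>\<^sub>M borel) (\<lambda>\<omega>. (X \<omega>, W \<omega>))) borel (\<lambda>(x, w). A *v x + \<sigma> *\<^sub>R w)"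
    by (subst distr_distr) (auto simp: o_def linear_step_def)
  also have "\<dots> = distr std_gaussian borel (\<lambda>w. A *v \<mu> + ?K *v w)"
    unfolding distr_indep_affine_std_gaussian[OF M X W indep]
    by (subst distr_distr) (auto simp: o_def hblock_mult_vec matrix_vector_right_distrib
        matrix_vector_mul_assoc add.assoc simp flip: scaleR_matrix_vector_assoc)
  also have "\<dots> = distr (distr std_gaussian borel (\<lambda>w. ?K *v w)) borel (\<lambda>x. A *v \<mu> + x)"
    by (subst distr_distr) (auto simp: o_def)
  also have "\<dots> = distr std_gaussian borel (\<lambda>w. A *v \<mu> + C *v w)"
    unfolding distr_std_gaussian_gram[OF inv C] by (subst distr_distr) (auto simp: o_def)
  finally show thesis by (rule that)
qed

lemma conditional_entropy_linear_gaussian: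
  fixes X W :: "'a \<Rightarrow> real ^ 'n" and B :: "real ^ 'n ^ 'n"
    and P :: "real ^ 'n ^ 'k" and J :: "real ^ 'n ^ 'j" and H :: "real ^ 'j ^ 'k" and N :: "real ^ 'k ^ 'k"
  assumes M: "prob_space M" and b: "b > 1" and \<sigma>: "\<sigma> \<noteq> 0"
    and X: "distr M borel X = distr std_gaussian borel (\<lambda>w. \<mu> + B *v w)"
    and W: "distr M borel W = std_gaussian"
    and indep: "prob_space.indep_var M borel X borel W"
    and P: "P ** transpose P = mat 1"
    and U: "\<And>\<omega>. \<omega> \<in> space M \<Longrightarrow> U \<omega> = m + H *v (J *v X \<omega>) + N *v (P *v X \<omega>) + \<sigma> *\<^sub>R (P *v W \<omega>)"
    and V: "\<And>\<omega>. \<omega> \<in> space M \<Longrightarrow> V \<omega> = P *v X \<omega>"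
  defines "\<Sigma> \<equiv> B ** transpose B"
  defines "Q \<equiv> H ** schur_compl (J ** \<Sigma> ** transpose J) (J ** \<Sigma> ** transpose P) (P ** \<Sigma> ** transpose P)
      ** transpose H + \<sigma>\<^sup>2 *\<^sub>R mat 1"
  assumes inv: "invertible (P ** \<Sigma> ** transpose P)"
  shows "det Q > 0" and
    "diff_cond_entropy M b U V = 1/2 * log b (det Q)
      - (\<integral>(w::real ^ 'k). log b (\<Prod>i\<in>UNIV. std_normal_density (w $ i)) \<partial>std_gaussian)"
proof -
  interpret prob_space M by fact
  have [measurable]: "X \<in> borel_measurable M" "W \<in> borel_measurable M"
    using indep by (auto simp: indep_var_distribution_eq)
  have [measurable]: "U \<in> borel_measurable M"
    by (subst measurable_cong[OF U]) measurable
  have [measurable]: "V \<in> borel_measurable M"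
    by (subst measurable_cong[OF V]) measurable
  define R where "R = P ** \<Sigma> ** transpose P"
  define E where "E = J ** \<Sigma> ** transpose P ** matrix_inv R"
  define F where "F = J - E ** P"
  define G where "G = N + H ** E"
  define K where "K = hblock (H ** F ** B) (\<sigma> *\<^sub>R P)"
  define L where "L = hblock (P ** B) (0 :: real ^ 'n ^ 'k)"
  define r where "r = m + H *v (F *v \<mu>)"
  define v where "v = P *v \<mu>"
  have \<Sigma>T: "transpose \<Sigma> = \<Sigma>"
    by (simp add: \<Sigma>_def matrix_transpose_mul)
  have R: "R ** matrix_inv R = mat 1" "matrix_inv R ** R = mat 1"
    using invertible_matrix_inv inv by (auto simp: R_def)
  have F\<Sigma>P: "F ** \<Sigma> ** transpose P = 0"
  proof -
    have "F ** \<Sigma> ** transpose P = J ** \<Sigma> ** transpose P - E ** R"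
      by (simp add: F_def R_def matrix_diff_rdistrib matrix_mul_assoc)
    also have "E ** R = J ** \<Sigma> ** transpose P ** (matrix_inv R ** R)"
      by (simp add: E_def matrix_mul_assoc)
    finally show ?thesis by (simp add: R)
  qed
  have schur: "F ** \<Sigma> ** transpose F = schur_compl (J ** \<Sigma> ** transpose J) (J ** \<Sigma> ** transpose P) R"
  proof -
    have "F ** \<Sigma> ** transpose F = F ** \<Sigma> ** transpose J - F ** \<Sigma> ** transpose P ** transpose E"
      by (simp add: F_def transpose_diff matrix_diff_ldistrib matrix_transpose_mul matrix_mul_assoc)
    also have "\<dots> = J ** \<Sigma> ** transpose J - E ** (P ** \<Sigma> ** transpose J)"
      by (simp add: F\<Sigma>P) (simp add: F_def matrix_diff_rdistrib matrix_mul_assoc)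
    also have "P ** \<Sigma> ** transpose J = transpose (J ** \<Sigma> ** transpose P)"
      by (simp add: matrix_transpose_mul \<Sigma>T matrix_mul_assoc)
    finally show ?thesis
      by (simp add: schur_compl_def E_def)
  qed
  have KK: "K ** transpose K = Q"
  proof -
    have "K ** transpose K = H ** (F ** \<Sigma> ** transpose F) ** transpose H + \<sigma>\<^sup>2 *\<^sub>R (P ** transpose P)"
      by (simp add: K_def hblock_mult_transpose transpose_scalar matrix_scalar_ac power2_eq_square
        matrix_transpose_mul matrix_mul_assoc \<Sigma>_def flip: scalar_matrix_assoc)
    then show ?thesis
      by (simp add: Q_def schur P R_def)
  qed
  have LL: "L ** transpose L = R"
    by (simp add: L_def hblock_mult_transpose R_def \<Sigma>_def matrix_transpose_mul matrix_mul_assoc)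
  have KL: "K ** transpose L = 0"
  proof -
    have "transpose (0 :: real ^ 'n ^ 'k) = 0"
      by (simp add: transpose_def vec_eq_iff)
    then have "K ** transpose L = H ** (F ** \<Sigma> ** transpose P)"
      by (simp add: K_def L_def hblock_mult_transpose \<Sigma>_def matrix_transpose_mul matrix_mul_assoc)
    then show ?thesis by (simp add: F\<Sigma>P)
  qed
  have invK: "invertible (K ** transpose K)"
  proof -
    have "K ** transpose K = (H ** F ** B) ** transpose (H ** F ** B) + \<sigma>\<^sup>2 *\<^sub>R mat 1"
      by (simp add: K_def hblock_mult_transpose transpose_scalar matrix_scalar_ac power2_eq_square P
        flip: scalar_matrix_assoc)
    then show ?thesis
      using invertible_gram_plus_scalar[OF \<sigma>] by simp
  qed
  have invL: "invertible (L ** transpose L)"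
    using inv by (simp add: LL R_def)
  obtain C :: "real ^ 'k ^ 'k" and D :: "real ^ 'k ^ 'k" where C: "C ** transpose C = K ** transpose K" and D: "D ** transpose D = L ** transpose L"
    and CD: "distr std_gaussian (borel \<Otimes>\<^sub>M borel) (\<lambda>w. (K *v w, L *v w))
      = distr (std_gaussian \<Otimes>\<^sub>M std_gaussian) (borel \<Otimes>\<^sub>M borel) (\<lambda>(a, b). (C *v a, D *v b))"
    using distr_std_gaussian_pair[OF invK invL KL] .
  have invCD: "invertible C" "invertible D"
    using invK invL invertible_gram_factor C D by metis+
  have detQ: "det Q = (det C)\<^sup>2"
    using C by (simp add: KK flip: det_gram)
  then show "det Q > 0"
    using invCD by (simp add: invertible_det_nz)
  have UV: "(m + H *v (J *v x) + N *v (P *v x) + \<sigma> *\<^sub>R (P *v w), P *v x)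
      = (r + K *v u + G *v (v + L *v u), v + L *v u)"
    if "x = \<mu> + B *v subvec Inl u" "w = subvec Inr u" for x w u
  proof -
    have Px: "P *v x = v + L *v u"
      by (simp add: that v_def L_def hblock_mult_vec matrix_vector_right_distrib matrix_vector_mul_assoc)
    have "J *v x = F *v x + E *v (P *v x)"
      by (simp add: F_def matrix_vector_mult_diff_rdistrib matrix_vector_mul_assoc)
    moreover have Gv: "G *v y = N *v y + H *v (E *v y)" for y
      by (simp add: G_def matrix_vector_mult_add_rdistrib matrix_vector_mul_assoc)
    ultimately have "m + H *v (J *v x) + N *v (P *v x) + \<sigma> *\<^sub>R (P *v w)
        = m + H *v (F *v x) + \<sigma> *\<^sub>R (P *v w) + G *v (P *v x)"
      by (simp add: Gv matrix_vector_right_distrib)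
    also have "m + H *v (F *v x) + \<sigma> *\<^sub>R (P *v w) = r + K *v u"
      by (simp add: that r_def K_def hblock_mult_vec matrix_vector_right_distrib matrix_vector_mul_assoc
          matrix_mul_assoc flip: scaleR_matrix_vector_assoc)
    finally show ?thesis by (simp add: Px)
  qed
  have "distr M (borel \<Otimes>\<^sub>M borel) (\<lambda>\<omega>. (U \<omega>, V \<omega>))
      = distr (distr M (borel \<Otimes>\<^sub>M borel) (\<lambda>\<omega>. (X \<omega>, W \<omega>))) (borel \<Otimes>\<^sub>M borel)
          (\<lambda>(x, w). (m + H *v (J *v x) + N *v (P *v x) + \<sigma> *\<^sub>R (P *v w), P *v x))"
    by (subst distr_distr) (auto simp: o_def U V intro!: distr_cong)
  also have "\<dots> = distr std_gaussian (borel \<Otimes>\<^sub>M borel) (\<lambda>u. (r + K *v u + G *v (v + L *v u), v + L *v u))"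
    unfolding distr_indep_affine_std_gaussian[OF M X W indep]
    by (subst distr_distr) (auto simp: o_def UV intro!: distr_cong)
  also have "\<dots> = distr (distr std_gaussian (borel \<Otimes>\<^sub>M borel) (\<lambda>u. (K *v u, L *v u))) (borel \<Otimes>\<^sub>M borel)
      (\<lambda>(x, y). (r + x + G *v (v + y), v + y))"
    by (subst distr_distr) (auto simp: o_def)
  also have "\<dots> = distr (std_gaussian \<Otimes>\<^sub>M std_gaussian) (borel \<Otimes>\<^sub>M borel)
      (\<lambda>(x, y). (r + C *v x + G *v (v + D *v y), v + D *v y))"
    unfolding CD by (subst distr_distr) (auto simp: o_def split_beta')
  finally have "diff_cond_entropy M b U V = log b \<bar>det C\<bar>
    - (\<integral>(w::real ^ 'k). log b (\<Prod>i\<in>UNIV. std_normal_density (w $ i)) \<partial>std_gaussian)"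
    by (intro conditional_entropy_std_gaussian_pair[OF M b invCD]) auto
  moreover have "log b \<bar>det C\<bar> = 1/2 * log b (det Q)"
  proof -
    have "log b (det Q) = log b (\<bar>det C\<bar> ^ 2)"
      by (simp add: detQ)
    also have "\<dots> = 2 * log b \<bar>det C\<bar>"
      using invCD by (subst log_nat_power) (auto simp: invertible_det_nz)
    finally show ?thesis by simp
  qed
  ultimately show "diff_cond_entropy M b U V = 1/2 * log b (det Q)
      - (\<integral>(w::real ^ 'k). log b (\<Prod>i\<in>UNIV. std_normal_density (w $ i)) \<partial>std_gaussian)"
    by simp
qed

subsection \<open>The linear system\<close>

definition selection :: "('k \<Rightarrow> 'n) \<Rightarrow> real ^ 'n ^ 'k" where
  "selection f = (\<chi> i. axis (f i) 1)"

lemma sum_axis_mult [simp]: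
  fixes g :: "'n::finite \<Rightarrow> real"
  shows "(\<Sum>k\<in>UNIV. axis a 1 $ k * g k) = g a" "(\<Sum>k\<in>UNIV. g k * axis a 1 $ k) = g a"
  by (simp_all add: axis_def if_distrib[of "\<lambda>x. x * _"] if_distrib[of "\<lambda>x. _ * x"] cong: if_cong)

lemma selection_mult_vec: "selection f *v x = subvec f x"
  by (simp add: selection_def subvec_def matrix_vector_mult_def vec_eq_iff)

lemma submat_eq_selection: "submat f g A = selection f ** A ** transpose (selection g)"
  by (simp add: submat_def selection_def matrix_matrix_mult_def transpose_def vec_eq_iff)

lemma selection_mult_transpose:
  assumes "inj f"
  shows "selection f ** transpose (selection f) = mat 1"
  using assms by (simp add: selection_def matrix_matrix_mult_def transpose_def vec_eq_iff mat_def)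
    (auto simp: axis_def inj_eq)

primrec linear_orbit :: "real ^ 'n ^ 'n \<Rightarrow> real \<Rightarrow> nat \<Rightarrow> (nat \<Rightarrow> real ^ 'n) \<Rightarrow> real ^ 'n" where
  "linear_orbit A \<sigma> 0 g = g 0"
| "linear_orbit A \<sigma> (Suc s) g = linear_step A \<sigma> (linear_orbit A \<sigma> s g) (g (Suc s))"

lemma measurable_linear_orbit:
  fixes A :: "real ^ 'n ^ 'n"
  shows "s \<le> t \<Longrightarrow> linear_orbit A \<sigma> s \<in> borel_measurable (\<Pi>\<^sub>M i\<in>{..t}. borel)"
proof (induction s)
  case 0
  have "linear_orbit A \<sigma> 0 = (\<lambda>g. g 0)" by auto
  then show ?case by simp
next
  case (Suc s)
  then have [measurable]: "linear_orbit A \<sigma> s \<in> borel_measurable (\<Pi>\<^sub>M i\<in>{..t}. borel)"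
    by simp
  have [measurable]: "(\<lambda>g. g (Suc s)) \<in> borel_measurable (\<Pi>\<^sub>M i\<in>{..t}. borel :: (real ^ 'n) measure)"
    using Suc.prems by simp
  have "linear_orbit A \<sigma> (Suc s) = (\<lambda>g. A *v linear_orbit A \<sigma> s g + \<sigma> *\<^sub>R g (Suc s))"
    by (auto simp: linear_step_def)
  then show ?case by simp
qed

lemma linear_orbit_restrict:
  "s \<le> t \<Longrightarrow> linear_orbit A \<sigma> s (restrict g {..t}) = linear_orbit A \<sigma> s g"
  by (induction s) auto

locale linear_gaussian_system =
  fixes M :: "'a measure" and A :: "real ^ 'n ^ 'n" and \<sigma> :: real and z \<xi> :: "nat \<Rightarrow> 'a \<Rightarrow> real ^ 'n"
  assumes M: "prob_space M" and \<sigma>: "\<sigma> \<noteq> 0"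
    and step: "\<And>s \<omega>. \<omega> \<in> space M \<Longrightarrow> z (Suc s) \<omega> = linear_step A \<sigma> (z s \<omega>) (\<xi> s \<omega>)"
    and noise: "\<And>s. distr M borel (\<xi> s) = std_gaussian"
    and indep: "prob_space.indep_vars M (\<lambda>_. borel) (case_nat (z 0) \<xi>) UNIV"
begin

lemma indep_state_noise: "prob_space.indep_var M borel (z t) borel (\<xi> t)"
proof -
  interpret prob_space M by (rule M)
  let ?X = "\<lambda>\<omega> i. case_nat (z 0) \<xi> i \<omega>"
  let ?z = "\<lambda>\<omega>. linear_orbit A \<sigma> t (?X \<omega>)"
  have z: "z s \<omega> = linear_orbit A \<sigma> s (?X \<omega>)" if "\<omega> \<in> space M" for s \<omega>
    using that by (induction s) (auto simp: step)
  have "indep_var (PiM {..t} (\<lambda>_. borel)) (\<lambda>\<omega>. restrict (?X \<omega>) {..t})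
      (PiM {Suc t} (\<lambda>_. borel)) (\<lambda>\<omega>. restrict (?X \<omega>) {Suc t})"
    by (rule indep_var_restrict[OF indep]) auto
  from indep_var_compose[OF this measurable_linear_orbit[OF order_refl] measurable_component_singleton[of "Suc t"]]
  have "indep_var borel ?z borel (\<xi> t)"
    by (simp add: o_def linear_orbit_restrict)
  then have rv: "?z \<in> borel_measurable M" "\<xi> t \<in> borel_measurable M"
    and eq: "distr M borel ?z \<Otimes>\<^sub>M distr M borel (\<xi> t) = distr M (borel \<Otimes>\<^sub>M borel) (\<lambda>\<omega>. (?z \<omega>, \<xi> t \<omega>))"
    by (auto simp: indep_var_distribution_eq)
  have "z t \<in> borel_measurable M"
    using rv(1) by (subst measurable_cong[OF z])
  moreover have "distr M borel (z t) = distr M borel ?z"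
    by (rule distr_cong) (auto simp: z)
  moreover have "distr M (borel \<Otimes>\<^sub>M borel) (\<lambda>\<omega>. (z t \<omega>, \<xi> t \<omega>)) = distr M (borel \<Otimes>\<^sub>M borel) (\<lambda>\<omega>. (?z \<omega>, \<xi> t \<omega>))"
    by (rule distr_cong) (auto simp: z)
  ultimately show ?thesis
    using rv eq by (simp add: indep_var_distribution_eq)
qed

lemma state_affine_std_gaussian:
  assumes init: "gaussian_vector M (z 0)"
  obtains \<mu> and B :: "real ^ 'n ^ 'n" where "distr M borel (z t) = distr std_gaussian borel (\<lambda>w. \<mu> + B *v w)"
proof -
  have "\<exists>\<mu> (B :: real ^ 'n ^ 'n). distr M borel (z t) = distr std_gaussian borel (\<lambda>w. \<mu> + B *v w)"
  proof (induction t)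
    case 0
    then show ?case using init by (auto simp: gaussian_vector_def)
  next
    case (Suc t)
    then obtain \<mu> and B :: "real ^ 'n ^ 'n" where "distr M borel (z t) = distr std_gaussian borel (\<lambda>w. \<mu> + B *v w)"
      by blast
    then obtain C :: "real ^ 'n ^ 'n" where "distr M borel (\<lambda>\<omega>. linear_step A \<sigma> (z t \<omega>) (\<xi> t \<omega>))
        = distr std_gaussian borel (\<lambda>w. A *v \<mu> + C *v w)"
      using linear_step_affine_std_gaussian[OF M _ noise indep_state_noise \<sigma>] by blast
    moreover have "distr M borel (z (Suc t)) = distr M borel (\<lambda>\<omega>. linear_step A \<sigma> (z t \<omega>) (\<xi> t \<omega>))"
      by (rule distr_cong) (auto simp: step)
    ultimately show ?case by metis
  qed
  then show thesis using that by blast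
qed

lemma conditional_entropy_state:
  fixes f :: "'j::finite \<Rightarrow> 'n" and y :: "'k::finite \<Rightarrow> 'n"
    and H :: "real ^ 'j ^ 'k" and N :: "real ^ 'k ^ 'k"
  assumes init: "gaussian_vector M (z 0)" and b: "b > 1" and y: "inj y"
    and inv: "invertible (submat y y (cov_matrix M (z t)))"
    and U: "\<forall>\<omega>\<in>space M.
      U \<omega> = m + H *v subvec f (z t \<omega>) + N *v subvec y (z t \<omega>) + \<sigma> *\<^sub>R subvec y (\<xi> t \<omega>)"
    and V: "\<forall>\<omega>\<in>space M. V \<omega> = subvec y (z t \<omega>)"
  defines "Q \<equiv> H ** schur_compl (submat f f (cov_matrix M (z t))) (submat f y (cov_matrix M (z t)))
      (submat y y (cov_matrix M (z t))) ** transpose H + \<sigma>\<^sup>2 *\<^sub>R mat 1"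
  shows "det Q > 0" and
    "diff_cond_entropy M b U V = 1/2 * log b (det Q)
      - (\<integral>(w::real ^ 'k). log b (\<Prod>i\<in>UNIV. std_normal_density (w $ i)) \<partial>std_gaussian)"
proof -
  interpret prob_space M by (rule M)
  obtain \<mu> and B :: "real ^ 'n ^ 'n" where
    law: "distr M borel (z t) = distr std_gaussian borel (\<lambda>w. \<mu> + B *v w)"
    using state_affine_std_gaussian[OF init] .
  have "z t \<in> borel_measurable M"
    using indep_state_noise by (simp add: indep_var_distribution_eq)
  then have cov: "cov_matrix M (z t) = B ** transpose B"
    by (rule cov_matrix_affine_std_gaussian(2)[OF _ law])
  have U': "U \<omega> = m + H *v (selection f *v z t \<omega>) + N *v (selection y *v z t \<omega>) + \<sigma> *\<^sub>R (selection y *v \<xi> t \<omega>)"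
    and V': "V \<omega> = selection y *v z t \<omega>" if "\<omega> \<in> space M" for \<omega>
    using that by (simp_all add: U V selection_mult_vec)
  have inv': "invertible (selection y ** (B ** transpose B) ** transpose (selection y))"
    using inv by (simp add: submat_eq_selection cov)
  note * = conditional_entropy_linear_gaussian[OF M b \<sigma> law noise indep_state_noise
      selection_mult_transpose[OF y] U' V' inv']
  show "det Q > 0" and "diff_cond_entropy M b U V = 1/2 * log b (det Q)
      - (\<integral>(w::real ^ 'k). log b (\<Prod>i\<in>UNIV. std_normal_density (w $ i)) \<partial>std_gaussian)"
    using * by (simp_all add: Q_def submat_eq_selection cov)
qed

end

lemma subvec_linear_step_sum:
  fixes A :: "real ^ ('x::finite + 'y::finite) ^ ('x + 'y)"
  shows "subvec Inr (linear_step A \<sigma> v w)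
    = submat Inr Inl A *v subvec Inl v + submat Inr Inr A *v subvec Inr v + \<sigma> *\<^sub>R subvec Inr w"
  by (simp add: linear_step_def subvec_def submat_def matrix_vector_mult_def sum_UNIV_sum vec_eq_iff)

lemma subvec_freeze:
  assumes "range f \<inter> a = {}"
  shows "subvec f (freeze a c v) = subvec f v"
  using assms by (auto simp: subvec_def freeze_def vec_eq_iff)

lemma subvec_freeze_frozen:
  assumes "range f \<subseteq> a"
  shows "subvec f (freeze a c v) = subvec f c"
  using assms by (auto simp: subvec_def freeze_def vec_eq_iff)

lemma submat_mult_subvec_bij:
  fixes e :: "'x1::finite + 'x2::finite \<Rightarrow> 'x::finite" and A :: "real ^ 'n ^ 'm" and v :: "real ^ 'n"
  assumes "bij e"
  shows "submat f g A *v subvec g v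
    = submat f (\<lambda>i. g (e (Inl i))) A *v subvec (\<lambda>i. g (e (Inl i))) v
    + submat f (\<lambda>i. g (e (Inr i))) A *v subvec (\<lambda>i. g (e (Inr i))) v"
  by (simp add: vec_eq_iff subvec_def submat_def matrix_vector_mult_def
      sum.reindex_bij_betw[OF assms, symmetric] sum_UNIV_sum)

theorem theorem7:
  fixes M :: "'a measure" and b \<sigma> :: real
    and A :: "real ^ ('x::finite + 'y::finite) ^ ('x + 'y)"
    and z \<xi> :: "nat \<Rightarrow> 'a \<Rightarrow> real ^ ('x + 'y)"
    and c :: "real ^ ('x + 'y)" and t :: nat
    and \<Sigma> :: "nat \<Rightarrow> real ^ ('x + 'y) ^ ('x + 'y)"
    and \<Sigma>\<^sub>x S :: "real ^ 'x ^ 'x" and \<Sigma>\<^sub>x\<^sub>y :: "real ^ 'y ^ 'x" and \<Sigma>\<^sub>y :: "real ^ 'y ^ 'y"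
    and A\<^sub>y\<^sub>x :: "real ^ 'x ^ 'y"
  assumes "prob_space M" and "b > 1" and "\<sigma> > 0"
    and z_step: "\<And>s \<omega>. \<omega> \<in> space M \<Longrightarrow> z (s + 1) \<omega> = linear_step A \<sigma> (z s \<omega>) (\<xi> s \<omega>)"
    and noise_gaussian: "\<And>s. gaussian_vector M (\<xi> s)"
    and noise_mean: "\<And>s i. (\<integral>\<omega>. \<xi> s \<omega> $ i \<partial>M) = 0"
    and noise_cov: "\<And>s. cov_matrix M (\<xi> s) = mat 1"
    and init_gaussian: "gaussian_vector M (z 0)"
    and indep: "prob_space.indep_vars M (\<lambda>_. borel) (case_nat (z 0) \<xi>) UNIV"
  defines "\<Sigma> \<equiv> \<lambda>s. cov_matrix M (z s)"
    and "\<Sigma>\<^sub>x \<equiv> submat Inl Inl (\<Sigma> t)"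
    and "\<Sigma>\<^sub>x\<^sub>y \<equiv> submat Inl Inr (\<Sigma> t)"
    and "\<Sigma>\<^sub>y \<equiv> submat Inr Inr (\<Sigma> t)"
    and "A\<^sub>y\<^sub>x \<equiv> submat Inr Inl A"
    and "S \<equiv> schur_compl \<Sigma>\<^sub>x \<Sigma>\<^sub>x\<^sub>y \<Sigma>\<^sub>y"
  assumes "invertible \<Sigma>\<^sub>y"
  shows "info_transfer M b (linear_step A \<sigma>) z \<xi> c (range Inl) Inr t =
           1/2 * log b (det (A\<^sub>y\<^sub>x ** S ** transpose A\<^sub>y\<^sub>x + \<sigma>\<^sup>2 *\<^sub>R mat 1) /
                        det (\<sigma>\<^sup>2 *\<^sub>R (mat 1 :: real ^ 'y ^ 'y)))
         \<and>
         (\<forall>e :: 'x1::finite + 'x2::finite \<Rightarrow> 'x. bij e \<longrightarrow>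
           (let x1 = (\<lambda>i. Inl (e (Inl i))) :: 'x1 \<Rightarrow> 'x + 'y;
                x2 = (\<lambda>i. Inl (e (Inr i))) :: 'x2 \<Rightarrow> 'x + 'y;
                \<Sigma>\<^sub>x\<^sub>2 = submat x2 x2 (\<Sigma> t);
                \<Sigma>\<^sub>x\<^sub>2\<^sub>y = submat x2 Inr (\<Sigma> t);
                A\<^sub>y\<^sub>x\<^sub>2 = submat Inr x2 A;
                S\<^sub>2 = schur_compl \<Sigma>\<^sub>x\<^sub>2 \<Sigma>\<^sub>x\<^sub>2\<^sub>y \<Sigma>\<^sub>y
            in info_transfer M b (linear_step A \<sigma>) z \<xi> c (range x1) Inr t =
                 1/2 * log b (det (A\<^sub>y\<^sub>x ** S ** transpose A\<^sub>y\<^sub>x + \<sigma>\<^sup>2 *\<^sub>R mat 1) /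
                              det (A\<^sub>y\<^sub>x\<^sub>2 ** S\<^sub>2 ** transpose A\<^sub>y\<^sub>x\<^sub>2 + \<sigma>\<^sup>2 *\<^sub>R mat 1))))"
proof -
  have M: "prob_space M" and b: "b > 1" and \<sigma>: "\<sigma> \<noteq> 0"
    using assms(1-3) by auto
  have step: "z (Suc s) \<omega> = linear_step A \<sigma> (z s \<omega>) (\<xi> s \<omega>)" if "\<omega> \<in> space M" for s \<omega>
    using z_step[OF that, of s] by simp
  have noise: "distr M borel (\<xi> s) = std_gaussian" for s
    by (rule gaussian_vector_std[OF noise_gaussian noise_mean noise_cov])
  have inv: "invertible (submat Inr Inr (cov_matrix M (z t)) :: real ^ 'y ^ 'y)"
    using \<open>invertible \<Sigma>\<^sub>y\<close> by (simp add: \<Sigma>\<^sub>y_def \<Sigma>_def)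
  interpret linear_gaussian_system M A \<sigma> z \<xi>
    by (rule linear_gaussian_system.intro[OF M \<sigma> step noise indep])
  note entropy = conditional_entropy_state[OF init_gaussian b inj_Inr inv]
  have log_diff: "1/2 * log b p - h - (1/2 * log b q - h) = 1/2 * log b (p / q)"
    if "p > 0" "q > 0" for p q h
    using that by (simp add: log_divide_pos right_diff_distrib)
  let ?N = "submat Inr Inr A :: real ^ 'y ^ 'y"
  let ?V = "\<lambda>\<omega>. subvec Inr (z t \<omega>) :: real ^ 'y"
  let ?U = "\<lambda>\<omega>. subvec Inr (z (t + 1) \<omega>) :: real ^ 'y"
  let ?Uf = "\<lambda>a \<omega>. subvec Inr (freeze a c (linear_step A \<sigma> (freeze a c (z t \<omega>)) (\<xi> t \<omega>))) :: real ^ 'y"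
  let ?Vf = "\<lambda>a \<omega>. subvec Inr (freeze a c (z t \<omega>)) :: real ^ 'y"
  have U: "\<forall>\<omega>\<in>space M. ?U \<omega> = 0 + A\<^sub>y\<^sub>x *v subvec Inl (z t \<omega>) + ?N *v subvec Inr (z t \<omega>) + \<sigma> *\<^sub>R subvec Inr (\<xi> t \<omega>)"
    using z_step[of _ t] by (simp add: subvec_linear_step_sum A\<^sub>y\<^sub>x_def)
  have Vf: "\<forall>\<omega>\<in>space M. ?Vf a \<omega> = subvec Inr (z t \<omega>)" if "a \<subseteq> range Inl" for a
    using that by (intro ballI subvec_freeze) auto
  have Uf: "?Uf a \<omega> = A\<^sub>y\<^sub>x *v subvec Inl (freeze a c (z t \<omega>)) + ?N *v subvec Inr (z t \<omega>) + \<sigma> *\<^sub>R subvec Inr (\<xi> t \<omega>)"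
    if "a \<subseteq> range Inl" and \<omega>: "\<omega> \<in> space M" for a \<omega>
  proof -
    have "?Uf a \<omega> = subvec Inr (linear_step A \<sigma> (freeze a c (z t \<omega>)) (\<xi> t \<omega>))"
      using that by (intro subvec_freeze) auto
    then show ?thesis
      using Vf[OF that(1)] \<omega> by (simp add: subvec_linear_step_sum A\<^sub>y\<^sub>x_def)
  qed
  note full = entropy[OF U ballI[OF refl]]
  show ?thesis
  proof (intro conjI allI impI)
    let ?a = "range Inl :: ('x + 'y) set"
    have "\<forall>\<omega>\<in>space M. ?Uf ?a \<omega> = A\<^sub>y\<^sub>x *v subvec Inl c + (0 :: real ^ 'x ^ 'y) *v subvec Inl (z t \<omega>)
        + ?N *v subvec Inr (z t \<omega>) + \<sigma> *\<^sub>R subvec Inr (\<xi> t \<omega>)"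
      by (simp add: Uf subvec_freeze_frozen)
    note frozen = entropy[OF this Vf[OF order_refl]]
    show "info_transfer M b (linear_step A \<sigma>) z \<xi> c ?a Inr t =
        1/2 * log b (det (A\<^sub>y\<^sub>x ** S ** transpose A\<^sub>y\<^sub>x + \<sigma>\<^sup>2 *\<^sub>R mat 1) / det (\<sigma>\<^sup>2 *\<^sub>R (mat 1 :: real ^ 'y ^ 'y)))"
      using log_diff[OF full(1) frozen(1)]
      unfolding info_transfer_def full(2) frozen(2)
      by (simp add: S_def \<Sigma>\<^sub>x_def \<Sigma>\<^sub>x\<^sub>y_def \<Sigma>\<^sub>y_def \<Sigma>_def)
  next
    fix e :: "'x1 + 'x2 \<Rightarrow> 'x" assume e: "bij e"
    define x1 :: "'x1 \<Rightarrow> 'x + 'y" where "x1 = (\<lambda>i. Inl (e (Inl i)))"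
    define x2 :: "'x2 \<Rightarrow> 'x + 'y" where "x2 = (\<lambda>i. Inl (e (Inr i)))"
    let ?a = "range x1"
    have a: "?a \<subseteq> range Inl" "range x2 \<inter> ?a = {}"
      using bij_is_inj[OF e] by (auto simp: x1_def x2_def inj_eq)
    have "\<forall>\<omega>\<in>space M. ?Uf ?a \<omega> = submat Inr x1 A *v subvec x1 c + submat Inr x2 A *v subvec x2 (z t \<omega>)
        + ?N *v subvec Inr (z t \<omega>) + \<sigma> *\<^sub>R subvec Inr (\<xi> t \<omega>)"
    proof -
      have "A\<^sub>y\<^sub>x *v subvec Inl v = submat Inr x1 A *v subvec x1 v + submat Inr x2 A *v subvec x2 v" for v
        unfolding A\<^sub>y\<^sub>x_def x1_def x2_def by (rule submat_mult_subvec_bij[OF e])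
      then show ?thesis
        using a by (simp add: Uf subvec_freeze_frozen[of x1] subvec_freeze[of x2])
    qed
    note frozen = entropy[OF this Vf[OF a(1)]]
    have "info_transfer M b (linear_step A \<sigma>) z \<xi> c ?a Inr t =
        1/2 * log b (det (A\<^sub>y\<^sub>x ** S ** transpose A\<^sub>y\<^sub>x + \<sigma>\<^sup>2 *\<^sub>R mat 1) /
          det (submat Inr x2 A ** schur_compl (submat x2 x2 (\<Sigma> t)) (submat x2 Inr (\<Sigma> t)) \<Sigma>\<^sub>y
            ** transpose (submat Inr x2 A) + \<sigma>\<^sup>2 *\<^sub>R mat 1))"
      using log_diff[OF full(1) frozen(1)]
      unfolding info_transfer_def full(2) frozen(2)
      by (simp add: S_def \<Sigma>\<^sub>x_def \<Sigma>\<^sub>x\<^sub>y_def \<Sigma>\<^sub>y_def \<Sigma>_def)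
    then show "let x1 = (\<lambda>i. Inl (e (Inl i))) :: 'x1 \<Rightarrow> 'x + 'y;
                x2 = (\<lambda>i. Inl (e (Inr i))) :: 'x2 \<Rightarrow> 'x + 'y;
                \<Sigma>\<^sub>x\<^sub>2 = submat x2 x2 (\<Sigma> t);
                \<Sigma>\<^sub>x\<^sub>2\<^sub>y = submat x2 Inr (\<Sigma> t);
                A\<^sub>y\<^sub>x\<^sub>2 = submat Inr x2 A;
                S\<^sub>2 = schur_compl \<Sigma>\<^sub>x\<^sub>2 \<Sigma>\<^sub>x\<^sub>2\<^sub>y \<Sigma>\<^sub>y
            in info_transfer M b (linear_step A \<sigma>) z \<xi> c (range x1) Inr t =
                 1/2 * log b (det (A\<^sub>y\<^sub>x ** S ** transpose A\<^sub>y\<^sub>x + \<sigma>\<^sup>2 *\<^sub>R mat 1) /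
                              det (A\<^sub>y\<^sub>x\<^sub>2 ** S\<^sub>2 ** transpose A\<^sub>y\<^sub>x\<^sub>2 + \<sigma>\<^sup>2 *\<^sub>R mat 1))"
      by (simp only: Let_def x1_def x2_def)
  qed
qed

end
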